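(* Let $n$ be a positive integer and let $\mathcal{G}$ be a dual equivalence graph of type $(n,n)$. Then every connected component of $\mathcal{G}$ is isomorphic to the standard dual equivalence graph $\mathcal{G}_\lambda$ for a unique partition $\lambda$ of $n$.
   Context: **Signed, colored graphs.** A signed, colored graph of type $(n,N)$, written $\mathcal{G}=(V,\sigma,E_2\cup\cdots\cup E_{n-1})$, consists of a finite vertex set $V$, a signature function $\sigma:V\to\{\pm1\}^{N-1}$ with coordinates $\sigma(v)_1,\dots,\sigma(v)_{N-1}$, and for each $1<i<n$ a collection $E_i$ of (unordered) pairs of distinct vertices, the edges of color $i$ (a pair may belong to several $E_i$). **Dual equivalence graphs.** A signed, colored graph of type $(n,N)$ is a dual equivalence graph of type $(n,N)$ if $n\le N$ and the following hold (conditions on coordinates of $\sigma$ being imposed only for indices in $\{1,\dots,N-1\}$). (ax1) For $w\in V$ and $1<i<n$, $\sigma(w)_{i-1}=-\sigma(w)_i$ if and only if there exists $x\in V$ with $\{w,x\}\in E_i$; moreover $x$ is unique when it exists. (ax2) For $\{w,x\}\in E_i$, $\sigma(w)_j=-\sigma(x)_j$ for $j=i-1,i$, and $\sigma(w)_h=\sigma(x)_h$ for $h<i-2$ and $h>i+1$. (ax3) For $\{w,x\}\in E_i$: if $\sigma(w)_{i-2}=-\sigma(x)_{i-2}$ then $\sigma(w)_{i-2}=-\sigma(w)_{i-1}$; and if $\sigma(w)_{i+1}=-\sigma(x)_{i+1}$ then $\sigma(w)_{i+1}=-\sigma(w)_i$. (ax4) For $2<i<n$, every connected component of $(V,\sigma,E_{i-1}\cup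 E_i)$ is, as an edge-colored graph, one of: a single vertex; a path on three vertices with one edge of color $i-1$ and one of color $i$; two vertices joined by both an edge of color $i-1$ and an edge of color $i$. For $3<i<n$, every connected component of $(V,\sigma,E_{i-2}\cup E_{i-1}\cup E_i)$ is one of: a single vertex; a path $v_1v_2v_3v_4$ with successive colors $i-2,i-1,i$; a graph on $v_1,\dots,v_5$ with $\{v_1,v_2\}\in E_{i-2}\cap E_{i-1}$, $\{v_2,v_3\}\in E_i$, $\{v_3,v_4\}\in E_{i-2}$, $\{v_4,v_5\}\in E_{i-1}\cap E_i$ and no other edges; a graph on six vertices $u,v,w,x,y,z$ with $\{u,v\}\in E_{i-1}$, $\{v,w\}\in E_{i-2}$, $\{v,x\}\in E_i$, $\{w,y\}\in E_i$, $\{x,y\}\in E_{i-2}$, $\{y,z\}\in E_{i-1}$ and no other edges. (ax5) If $\{w,x\}\in E_i$ and $\{x,y\}\in E_j$ with $|i-j|\ge3$, then $\{w,v\}\in E_j$ and $\{v,y\}\in E_i$ for some $v\in V$. (ax6) For each $1<i<n$, any two vertices of a connected component of $(V,\sigma,E_2\cup\cdots\cup E_i)$ may be connected by a path crossing at most one $E_i$ edge. **Standard graphs.** The diagram of a partition $\lambda$ is the set of cells $(i,j)$ with $1\le i\le\lambda_j$ ($i$ the column, $j$ the row, rows numbered from bottom to top). $\mathrm{SYT}(\lambda)$ is the set of standard Young tableaux of shape $\lambda$: bijective fillings by $1,\dots,n$ increasing along rows left to right and up columns. The content of $(i,j)$ is $i-j$. The content reading word $w_T$ lists the entries of $T$ in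 increasing order of content, reading each diagonal (constant content) southwest to northeast. The descent signature is $\sigma(T)\in\{\pm1\}^{n-1}$ with $\sigma(T)_i=+1$ if $i$ is to the left of $i+1$ in $w_T$, and $-1$ otherwise. An elementary dual equivalence for $i-1,i,i+1$ is defined on permutations in which $i$ does not lie between $i-1$ and $i+1$ in position: among the three letters $i-1,i,i+1$, it switches the two in the outermost positions. $\mathcal{G}_\lambda$ is the signed, colored graph of type $(n,n)$ on $\mathrm{SYT}(\lambda)$ with signature $\sigma(T)$ and $\{T,U\}\in E_i$ iff $w_T$ and $w_U$ differ by an elementary dual equivalence for $i-1,i,i+1$. **Isomorphism.** A morphism from $(V,\sigma,E)$ to $(W,\tau,F)$, both of type $(n,N)$, is a map $\phi:V\to W$ with $\sigma(v)_i=\tau(\phi(v))_i$ for all $v$ and $1\le i<N$, and $\{u,v\}\in E_i\Rightarrow\{\phi(u),\phi(v)\}\in F_i$ for all $1<i<n$. It is an isomorphism if it is a bijection on vertex sets. *)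

theory Defs
  imports Main "HOL-Library.FuncSet" "HOL-Combinatorics.Transposition"
begin

section \<open>Signed, colored graphs\<close>

text \<open>
  The type \<open>(n, N)\<close> is not part of the record. In a graph of type \<open>(n, N)\<close> only the signature
  coordinates \<open>1, \<dots>, N - 1\<close> and the edge colors \<open>2, \<dots>, n - 1\<close> are meaningful; every definition
  below ignores the values of the fields outside these ranges.
\<close>

record 'v sc_graph =
  verts :: "'v set"
  sig :: "'v \<Rightarrow> nat \<Rightarrow> int"
  edges :: "nat \<Rightarrow> 'v set set"

definition sc_graph_of_type :: "nat \<Rightarrow> nat \<Rightarrow> 'v sc_graph \<Rightarrow> bool" where
  "sc_graph_of_type n N G \<longleftrightarrow>
     finite (verts G) \<and>
     (\<forall>v\<in>verts G. \<forall>i\<in>{1..<N}. sig G v i \<in> {1, -1}) \<and>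
     (\<forall>i\<in>{2..<n}. edges G i \<subseteq> {{u, v} |u v. u \<in> verts G \<and> v \<in> verts G \<and> u \<noteq> v})"

text \<open>
  A walk is recorded by the colors of the edges it crosses. A pair of vertices that belongs to
  several color classes can thus be crossed through an edge of any one of these colors.
\<close>

fun walk :: "'v sc_graph \<Rightarrow> 'v \<Rightarrow> nat list \<Rightarrow> 'v \<Rightarrow> bool" where
  "walk G u [] v \<longleftrightarrow> u \<in> verts G \<and> u = v"
| "walk G u (c # cs) v \<longleftrightarrow> u \<in> verts G \<and> (\<exists>x. {u, x} \<in> edges G c \<and> walk G x cs v)"

text \<open>Vertex sets of the connected components of \<open>G\<close> when only the edges with color in \<open>C\<close> are kept.\<close>

definition components :: "'v sc_graph \<Rightarrow> nat set \<Rightarrow> 'v set set" where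
  "components G C = {{w. \<exists>cs. set cs \<subseteq> C \<and> walk G v cs w} |v. v \<in> verts G}"

definition induced_subgraph :: "'v sc_graph \<Rightarrow> 'v set \<Rightarrow> 'v sc_graph" where
  "induced_subgraph G W = \<lparr>verts = W, sig = sig G, edges = (\<lambda>i. {e \<in> edges G i. e \<subseteq> W})\<rparr>"

definition morphism ::
    "nat \<Rightarrow> nat \<Rightarrow> ('v \<Rightarrow> 'w) \<Rightarrow> 'v sc_graph \<Rightarrow> 'w sc_graph \<Rightarrow> bool" where
  "morphism n N \<phi> G H \<longleftrightarrow>
     \<phi> \<in> verts G \<rightarrow> verts H \<and>
     (\<forall>v\<in>verts G. \<forall>i\<in>{1..<N}. sig G v i = sig H (\<phi> v) i) \<and>
     (\<forall>i\<in>{2..<n}. \<forall>u\<in>verts G. \<forall>v\<in>verts G. {u, v} \<in> edges G i \<longrightarrow> {\<phi> u, \<phi> v} \<in> edges H i)"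

definition isomorphic :: "nat \<Rightarrow> nat \<Rightarrow> 'v sc_graph \<Rightarrow> 'w sc_graph \<Rightarrow> bool" where
  "isomorphic n N G H \<longleftrightarrow> (\<exists>\<phi>. morphism n N \<phi> G H \<and> bij_betw \<phi> (verts G) (verts H))"


section \<open>Dual equivalence graphs\<close>

definition ax1 :: "nat \<Rightarrow> 'v sc_graph \<Rightarrow> bool" where
  "ax1 n G \<longleftrightarrow> (\<forall>w\<in>verts G. \<forall>i\<in>{2..<n}.
     (sig G w (i - 1) = - sig G w i \<longleftrightarrow> (\<exists>x\<in>verts G. {w, x} \<in> edges G i)) \<and>
     (\<forall>x\<in>verts G. \<forall>y\<in>verts G. {w, x} \<in> edges G i \<longrightarrow> {w, y} \<in> edges G i \<longrightarrow> x = y))"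

definition ax2 :: "nat \<Rightarrow> nat \<Rightarrow> 'v sc_graph \<Rightarrow> bool" where
  "ax2 n N G \<longleftrightarrow> (\<forall>i\<in>{2..<n}. \<forall>w x. {w, x} \<in> edges G i \<longrightarrow>
     (\<forall>j\<in>{i - 1, i}. sig G w j = - sig G x j) \<and>
     (\<forall>h\<in>{1..<N}. h < i - 2 \<or> h > i + 1 \<longrightarrow> sig G w h = sig G x h))"

definition ax3 :: "nat \<Rightarrow> nat \<Rightarrow> 'v sc_graph \<Rightarrow> bool" where
  "ax3 n N G \<longleftrightarrow> (\<forall>i\<in>{2..<n}. \<forall>w x. {w, x} \<in> edges G i \<longrightarrow>
     (i - 2 \<in> {1..<N} \<and> sig G w (i - 2) = - sig G x (i - 2) \<longrightarrow>
        sig G w (i - 2) = - sig G w (i - 1)) \<and>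
     (i + 1 \<in> {1..<N} \<and> sig G w (i + 1) = - sig G x (i + 1) \<longrightarrow>
        sig G w (i + 1) = - sig G w i))"

text \<open>
  On the pairwise distinct vertices \<open>vs\<close>, which exhaust \<open>W\<close>, the edges of \<open>G\<close> inside \<open>W\<close> with
  color in \<open>C\<close> are exactly the ones listed in \<open>es\<close> (as pairs of a color and an edge).
\<close>

definition colored_graph_is ::
    "'v sc_graph \<Rightarrow> nat set \<Rightarrow> 'v set \<Rightarrow> 'v list \<Rightarrow> (nat \<times> 'v set) set \<Rightarrow> bool" where
  "colored_graph_is G C W vs es \<longleftrightarrow>
     distinct vs \<and> set vs = W \<and> {(c, e). c \<in> C \<and> e \<in> edges G c \<and> e \<subseteq> W} = es"

definition ax4 :: "nat \<Rightarrow> 'v sc_graph \<Rightarrow> bool" where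
  "ax4 n G \<longleftrightarrow>
     (\<forall>i. 2 < i \<and> i < n \<longrightarrow> (\<forall>W\<in>components G {i - 1, i}.
        let is = colored_graph_is G {i - 1, i} W in
        (\<exists>a. is [a] {}) \<or>
        (\<exists>a b c. is [a, b, c] {(i - 1, {a, b}), (i, {b, c})}) \<or>
        (\<exists>a b. is [a, b] {(i - 1, {a, b}), (i, {a, b})}))) \<and>
     (\<forall>i. 3 < i \<and> i < n \<longrightarrow> (\<forall>W\<in>components G {i - 2, i - 1, i}.
        let is = colored_graph_is G {i - 2, i - 1, i} W in
        (\<exists>a. is [a] {}) \<or>
        (\<exists>a b c d. is [a, b, c, d] {(i - 2, {a, b}), (i - 1, {b, c}), (i, {c, d})}) \<or>
        (\<exists>a b c d e. is [a, b, c, d, e]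
           {(i - 2, {a, b}), (i - 1, {a, b}), (i, {b, c}), (i - 2, {c, d}),
            (i - 1, {d, e}), (i, {d, e})}) \<or>
        (\<exists>u v w x y z. is [u, v, w, x, y, z]
           {(i - 1, {u, v}), (i - 2, {v, w}), (i, {v, x}), (i, {w, y}),
            (i - 2, {x, y}), (i - 1, {y, z})})))"

definition ax5 :: "nat \<Rightarrow> 'v sc_graph \<Rightarrow> bool" where
  "ax5 n G \<longleftrightarrow> (\<forall>i\<in>{2..<n}. \<forall>j\<in>{2..<n}. \<bar>int i - int j\<bar> \<ge> 3 \<longrightarrow>
     (\<forall>w x y. {w, x} \<in> edges G i \<longrightarrow> {x, y} \<in> edges G j \<longrightarrow>
        (\<exists>v\<in>verts G. {w, v} \<in> edges G j \<and> {v, y} \<in> edges G i)))"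

text \<open>
  What is bounded is the number of crossings made through color \<open>i\<close>: an edge of color \<open>i - 1\<close>
  parallel to an edge of color \<open>i\<close> may be used freely. Bounding the number of crossed pairs lying
  in \<open>E\<^sub>i\<close> instead would already exclude the standard graph of shape \<open>(3, 2)\<close>.
\<close>

definition ax6 :: "nat \<Rightarrow> 'v sc_graph \<Rightarrow> bool" where
  "ax6 n G \<longleftrightarrow> (\<forall>i\<in>{2..<n}. \<forall>W\<in>components G {2..i}. \<forall>u\<in>W. \<forall>v\<in>W.
     \<exists>cs. set cs \<subseteq> {2..i} \<and> walk G u cs v \<and> count_list cs i \<le> 1)"

definition dual_equivalence_graph :: "nat \<Rightarrow> nat \<Rightarrow> 'v sc_graph \<Rightarrow> bool" where
  "dual_equivalence_graph n N G \<longleftrightarrow>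
     n \<le> N \<and> sc_graph_of_type n N G \<and>
     ax1 n G \<and> ax2 n N G \<and> ax3 n N G \<and> ax4 n G \<and> ax5 n G \<and> ax6 n G"


section \<open>Standard graphs\<close>

text \<open>A partition is the list of its positive parts in weakly decreasing order.\<close>

definition partition_of :: "nat \<Rightarrow> nat list \<Rightarrow> bool" where
  "partition_of n l \<longleftrightarrow> sorted_wrt (\<ge>) l \<and> 0 \<notin> set l \<and> sum_list l = n"

text \<open>A cell is a pair (column, row), both counted from 1, with rows numbered from the bottom.\<close>

definition diagram :: "nat list \<Rightarrow> (nat \<times> nat) set" where
  "diagram l = {(i, j). 1 \<le> j \<and> j \<le> length l \<and> 1 \<le> i \<and> i \<le> l ! (j - 1)}"

definition SYT :: "nat list \<Rightarrow> (nat \<times> nat \<Rightarrow> nat) set" where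
  "SYT l = {T \<in> extensional (diagram l).
     bij_betw T (diagram l) {1..sum_list l} \<and>
     (\<forall>i i' j. (i, j) \<in> diagram l \<and> (i', j) \<in> diagram l \<and> i < i' \<longrightarrow> T (i, j) < T (i', j)) \<and>
     (\<forall>i j j'. (i, j) \<in> diagram l \<and> (i, j') \<in> diagram l \<and> j < j' \<longrightarrow> T (i, j) < T (i, j'))}"

definition content :: "nat \<times> nat \<Rightarrow> int" where
  "content = (\<lambda>(i, j). int i - int j)"

text \<open>
  The cells are first listed by increasing column. As \<open>sort_key\<close> is stable, cells of
  equal content remain in that order, that is, from southwest to northeast.
\<close>

definition reading_order :: "nat list \<Rightarrow> (nat \<times> nat) list" where
  "reading_order l = sort_key content
     (filter (\<lambda>c. c \<in> diagram l)
        (List.product [1..<sum_list l + 1] [1..<sum_list l + 1]))"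

definition content_word :: "nat list \<Rightarrow> (nat \<times> nat \<Rightarrow> nat) \<Rightarrow> nat list" where
  "content_word l T = map T (reading_order l)"

definition left_of :: "nat list \<Rightarrow> nat \<Rightarrow> nat \<Rightarrow> bool" where
  "left_of w a b \<longleftrightarrow> (\<exists>p q. p < q \<and> q < length w \<and> w ! p = a \<and> w ! q = b)"

definition descent_sig :: "nat list \<Rightarrow> (nat \<times> nat \<Rightarrow> nat) \<Rightarrow> nat \<Rightarrow> int" where
  "descent_sig l T i = (if left_of (content_word l T) i (i + 1) then 1 else -1)"

text \<open>
  For a permutation \<open>w\<close> of \<open>1, \<dots>, n\<close> and \<open>1 < i < n\<close>, the word \<open>s\<close> consists of the three letters
  \<open>i - 1, i, i + 1\<close> in the order of their positions in \<open>w\<close>.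
\<close>

definition elem_dual_equiv :: "nat \<Rightarrow> nat list \<Rightarrow> nat list \<Rightarrow> bool" where
  "elem_dual_equiv i w w' \<longleftrightarrow>
     (let s = filter (\<lambda>a. a \<in> {i - 1, i, i + 1}) w in
        s ! 1 \<noteq> i \<and> w' = map (Transposition.transpose (s ! 0) (s ! 2)) w)"

definition standard_graph :: "nat list \<Rightarrow> (nat \<times> nat \<Rightarrow> nat) sc_graph" where
  "standard_graph l =
     \<lparr>verts = SYT l,
      sig = descent_sig l,
      edges = (\<lambda>i. {{T, U} |T U. 1 < i \<and> i < sum_list l \<and> T \<in> SYT l \<and> U \<in> SYT l \<and>
                    elem_dual_equiv i (content_word l T) (content_word l U)})\<rparr>"

end

theory Submission
  imports Defs
begin

text \<open>
  A standard tableau is encoded by the sequence of contents of its letters, and every vertex \<open>v\<close>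
  of the graph receives such a sequence one letter at a time. Once the letters \<open>1, \<dots>, m\<close> are
  placed, the components for the colors below \<open>m\<close> are standard graphs, and the axioms 2 and 3 force
  the sign \<open>\<sigma>\<^sub>m\<close> to be monotone in the removable corner that contains \<open>m\<close>. Removable and addable
  corners alternate along the boundary of the shape, so exactly one addable cell for \<open>m + 1\<close>
  explains these signs. Axioms 4 and 5 show that an edge of color \<open>m\<close> then acts as the elementary
  dual equivalence for \<open>m - 1, m, m + 1\<close>. By axiom 6 two vertices with the same sequence in one
  component would be joined through a single edge of color \<open>m\<close> that keeps \<open>m + 1\<close> in place, but
  such an edge does not leave the component for the smaller colors, where labels are already distinct.
  The labels depend only on signatures and components, which gives the uniqueness of the partition.
\<close>

section \<open>Content sequences\<close>

text \<open>At \<open>v\<close> alone the sign of index \<open>m\<close> seldom determines the cell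
  of the letter \<open>m + 1\<close>; a label therefore has to account for the signs on a whole
  component, where the letter \<open>m\<close> visits every removable corner. The price is paid at
  the edges of color \<open>m\<close>: to know where such an edge sends a letter, one must know
  signs all over the component of its other end. Axiom 5 carries the edge along walks of colors at
  most \<open>m - 3\<close>, which rearrange only the letters up to \<open>m - 2\<close>. The
  letters \<open>m - 1\<close>, \<open>m\<close> and \<open>m + 1\<close> are out of its reach. They
  are settled one after the other, by arranging the smaller letters at both ends at once until the
  edge lies in a small component of axiom 4 whose form can be recognized from signs. Hence the
  passage to \<open>m + 1\<close> uses the labels of three consecutive levels. All this is
  arithmetic of contents; tableaux enter only at the end.\<close>

text \<open>
  Content sequences are stored with the largest letter first. The shape is kept as its boundary path,
  read from northwest to southeast: at \<open>k\<close> it is the number of cells of content \<open>k\<close> minus the number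
  of those of content \<open>k - 1\<close>, plus one if \<open>k > 0\<close> (see \<open>shape_count\<close> below), and this is 0 or 1.
  Adding a cell of content \<open>c\<close> exchanges the steps \<open>c\<close> and \<open>c + 1\<close>.
\<close>

fun shape :: "int list \<Rightarrow> int \<Rightarrow> bool" where
  "shape [] = (\<lambda>k. 0 < k)"
| "shape (c # t) = (shape t)(c := True, c + 1 := False)"

lemma shape_Cons: "shape (c # t) k \<longleftrightarrow> k = c \<or> k \<noteq> c + 1 \<and> shape t k"
  by auto

declare shape.simps(2) [simp del]

lemma shape_Cons_cong: "shape t = shape t' \<Longrightarrow> shape (c # t) = shape (c # t')"
  by (simp add: shape.simps(2))

text \<open>\<open>False\<close> is a vertical and \<open>True\<close> a horizontal step of the
  path; going southeast, a step down followed by a step to the right leaves room for a cell.\<close>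

definition addable :: "(int \<Rightarrow> bool) \<Rightarrow> int \<Rightarrow> bool" where
  "addable b k \<longleftrightarrow> \<not> b k \<and> b (k + 1)"

definition removable :: "(int \<Rightarrow> bool) \<Rightarrow> int \<Rightarrow> bool" where
  "removable b k \<longleftrightarrow> b k \<and> \<not> b (k + 1)"

fun valid :: "int list \<Rightarrow> bool" where
  "valid [] = True"
| "valid (c # t) \<longleftrightarrow> valid t \<and> addable (shape t) c"

lemma removable_shape_Cons: "removable (shape (c # t)) c"
  by (simp add: removable_def shape_Cons)

lemma valid_swap:
  assumes "valid (b # a # t)" "b \<noteq> a + 1" "b \<noteq> a - 1"
  shows "valid (a # b # t)" "shape (a # b # t) = shape (b # a # t)"
  using assms by (auto simp: addable_def fun_eq_iff shape_Cons split: if_splits)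

lemma valid_Cons_Cons_addable:
  assumes "valid (b # a # t)" "b \<noteq> a + 1" "b \<noteq> a - 1"
  shows "addable (shape t) a" "addable (shape t) b"
  using assms by (auto simp: addable_def shape_Cons split: if_splits)

lemma valid2_neq: "valid (b # a # t) \<Longrightarrow> a \<noteq> b"
  by (auto simp: addable_def shape_Cons)

lemma valid3_neq: "valid (c # b # a # t) \<Longrightarrow> a \<noteq> b \<and> b \<noteq> c \<and> a \<noteq> c"
  by (auto simp: addable_def shape_Cons split: if_splits)

lemma shape_low: "\<exists>K. \<forall>k\<le>K. \<not> shape t k"
proof (induction t)
  case (Cons c t)
  then obtain K where "\<forall>k\<le>K. \<not> shape t k" by blast
  then show ?case by (intro exI[of _ "min K (c - 1)"]) (auto simp: shape_Cons)
qed (auto intro: exI[of _ 0])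

lemma shape_high: "\<exists>K. \<forall>k\<ge>K. shape t k"
proof (induction t)
  case (Cons c t)
  then obtain K where "\<forall>k\<ge>K. shape t k" by blast
  then show ?case by (intro exI[of _ "max K (c + 2)"]) (auto simp: shape_Cons)
qed (auto intro: exI[of _ 1])

section \<open>Corners of the boundary path\<close>

lemma first_True:
  fixes b :: "int \<Rightarrow> bool"
  assumes "\<not> b x" "b y" "x < y"
  shows "\<exists>c. x \<le> c \<and> c < y \<and> (\<forall>z. x \<le> z \<and> z \<le> c \<longrightarrow> \<not> b z) \<and> b (c + 1)"
proof -
  define P where "P k \<longleftrightarrow> b (x + int k)" for k
  have P1: "P (nat (y - x))" using assms by (simp add: P_def)
  define k where "k = (LEAST k. P k)"
  have Pk: "P k" and le: "k \<le> nat (y - x)" unfolding k_def using P1 by (rule LeastI, rule Least_le)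
  have k0: "k > 0" using Pk assms(1) by (cases "k = 0") (auto simp: P_def)
  have "\<not> b z" if "x \<le> z" "z \<le> x + int k - 1" for z
  proof -
    have "nat (z - x) < k" using that by linarith
    then have "\<not> P (nat (z - x))" unfolding k_def by (rule not_less_Least)
    then show ?thesis using that by (simp add: P_def)
  qed
  moreover have "b (x + int k - 1 + 1)" using Pk by (simp add: P_def)
  moreover have "x \<le> x + int k - 1" "x + int k - 1 < y" using k0 le assms(3) by linarith+
  ultimately show ?thesis by blast
qed

text \<open>Step \<open>x + 1\<close> is horizontal and step \<open>y\<close> is vertical, so some
  horizontal step from \<open>x + 1\<close> on is followed by a vertical one.\<close>

lemma removable_between:
  assumes "addable b x" "addable b y" "x < y"
  shows "\<exists>s. x < s \<and> s < y \<and> removable b s"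
proof -
  have "x + 1 \<noteq> y" using assms(1,2) unfolding addable_def by metis
  then have "x + 1 < y" using assms(3) by linarith
  then obtain c where "x + 1 \<le> c" "c < y" "\<forall>z. x + 1 \<le> z \<and> z \<le> c \<longrightarrow> b z" "\<not> b (c + 1)"
    using first_True[of "\<lambda>z. \<not> b z" "x + 1" y] assms by (auto simp: addable_def)
  then show ?thesis by (intro exI[of _ c]) (auto simp: removable_def)
qed

text \<open>If the head \<open>c\<close> is not at \<open>r\<close>, then \<open>r\<close> was
  removable already before \<open>c\<close> was added and is not adjacent to \<open>c\<close>. By
  induction the next letter can be put at \<open>r\<close>, and then the two largest letters
  commute.\<close>

lemma removable_last:
  assumes "valid t" "removable (shape t) r"
  shows "\<exists>t0. valid (r # t0) \<and> shape (r # t0) = shape t \<and> length t = Suc (length t0)"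
  using assms
proof (induction t)
  case (Cons c t)
  show ?case
  proof (cases "r = c")
    case False
    then have d: "r \<noteq> c + 1" "r \<noteq> c - 1" and "removable (shape t) r"
      using Cons.prems by (auto simp: removable_def shape_Cons split: if_splits)
    then have "\<exists>t0. valid (r # t0) \<and> shape (r # t0) = shape t \<and> length t = Suc (length t0)"
      using Cons.IH Cons.prems(1) by simp
    then obtain t0 where t0: "valid (r # t0)" "shape (r # t0) = shape t" "length t = Suc (length t0)"
      by (elim exE conjE)
    then have "valid (c # r # t0)" using Cons.prems(1) by (metis valid.simps(2))
    moreover have "c \<noteq> r + 1" "c \<noteq> r - 1" using d by auto
    ultimately have "valid (r # c # t0)" "shape (r # c # t0) = shape (c # r # t0)"
      using valid_swap by blast+
    then show ?thesis using t0 by (intro exI[of _ "c # t0"]) (metis length_Cons shape.simps(2))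
  next
    case True
    then show ?thesis using Cons.prems by (intro exI[of _ t]) simp
  qed
qed (auto simp: removable_def)

text \<open>Once two removable corners are emptied, both are addable, so a third corner
  \<open>s\<close> lies strictly between them. With the next smaller letter at \<open>s\<close>, the
  exchange of the two largest letters is an elementary dual equivalence.\<close>

lemma two_corners:
  assumes "valid (a # t)" "removable (shape (a # t)) r" "r \<noteq> a"
  obtains s t2 where "min a r < s" "s < max a r"
    "valid (a # r # s # t2)" "valid (r # a # s # t2)"
    "shape (r # s # t2) = shape t" "shape (r # a # s # t2) = shape (a # t)"
    "length t = length t2 + 2"
proof -
  have d: "r \<noteq> a + 1" "r \<noteq> a - 1" and rt: "removable (shape t) r"
    using assms by (auto simp: removable_def shape_Cons split: if_splits)
  obtain t1 where t1: "valid (r # t1)" "shape (r # t1) = shape t" "length t = Suc (length t1)"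
    using removable_last[OF _ rt] assms(1) by (metis valid.simps(2))
  have v: "valid (a # r # t1)" using t1 assms(1) by (metis valid.simps(2))
  have d': "a \<noteq> r + 1" "a \<noteq> r - 1" using d by auto
  note ad = valid_Cons_Cons_addable[OF v d']
  obtain s where s: "min a r < s" "s < max a r" "removable (shape t1) s"
    using removable_between[OF ad] removable_between[OF ad(2,1)] assms(3)
    by (cases "a < r") auto
  obtain t2 where t2: "valid (s # t2)" "shape (s # t2) = shape t1" "length t1 = Suc (length t2)"
    using removable_last[OF _ s(3)] t1 by (metis valid.simps(2))
  have v': "valid (a # r # s # t2)" using v t2 by (metis valid.simps(2) shape.simps(2))
  have sh: "shape (r # s # t2) = shape t" using t1 t2 by (metis shape.simps(2))
  show ?thesis
  proof (rule that[OF s(1,2) v' _ sh])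
    show "valid (r # a # s # t2)" by (rule valid_swap(1)[OF v' d'])
    show "shape (r # a # s # t2) = shape (a # t)"
      using valid_swap(2)[OF v' d'] sh by (metis shape.simps(2))
    show "length t = length t2 + 2" using t1 t2 by simp
  qed
qed

text \<open>The letter \<open>i + 1\<close> is the head of the suffix of length \<open>i + 1\<close>.\<close>

fun asc :: "nat \<Rightarrow> int list \<Rightarrow> bool" where
  "asc i [] = False"
| "asc i (c # t) = (if length t = i then hd t < c else asc i t)"

text \<open>The heads \<open>c\<close>, \<open>b\<close>, \<open>a\<close> are the contents of the
  letters \<open>i + 1\<close>, \<open>i\<close>, \<open>i - 1\<close>. The branches ask which
  letter has the middle content and exchange the other two; if it is \<open>i\<close>, no dual
  equivalence applies and the sequence is kept.\<close>

fun top3 :: "int list \<Rightarrow> int list" where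
  "top3 (c # b # a # t) =
     (if a < b \<and> b < c \<or> c < b \<and> b < a then c # b # a # t
      else if a < c \<and> c < b \<or> b < c \<and> c < a then c # a # b # t
      else b # c # a # t)"
| "top3 t = t"

fun dual_equiv :: "nat \<Rightarrow> int list \<Rightarrow> int list" where
  "dual_equiv i [] = []"
| "dual_equiv i (c # t) = (if length t = i then top3 (c # t) else c # dual_equiv i t)"

lemma length_top3 [simp]: "length (top3 t) = length t"
  by (cases t rule: top3.cases) auto

lemma length_dual_equiv [simp]: "length (dual_equiv i t) = length t"
  by (induction t) auto

text \<open>The middle content lies strictly between the two that are exchanged, so these are not
  adjacent and \<open>valid_swap\<close> applies.\<close>

lemma top3_valid: "valid t \<Longrightarrow> valid (top3 t) \<and> shape (top3 t) = shape t"
proof (cases t rule: top3.cases)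
  case (1 c b a t')
  assume "valid t"
  then have v: "valid (c # b # a # t')" using 1 by simp
  then have v2: "valid (b # a # t')" and ne: "a \<noteq> b" "b \<noteq> c" "a \<noteq> c"
    using valid3_neq[OF v] by simp_all
  consider "a < b \<and> b < c \<or> c < b \<and> b < a" | "a < c \<and> c < b \<or> b < c \<and> c < a"
    | "b < a \<and> a < c \<or> c < a \<and> a < b"
    using ne by linarith
  then show ?thesis
  proof cases
    case 1
    then have "top3 t = t" using \<open>t = c # b # a # t'\<close> by simp
    then show ?thesis using \<open>valid t\<close> by simp
  next
    case 2
    then have "top3 t = c # a # b # t'" "b \<noteq> a + 1" "b \<noteq> a - 1" using \<open>t = c # b # a # t'\<close> by auto
    then show ?thesis using valid_swap[OF v2] v unfolding \<open>t = c # b # a # t'\<close>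
      by (metis shape.simps(2) valid.simps(2))
  next
    case 3
    then have "top3 t = b # c # a # t'" "c \<noteq> b + 1" "c \<noteq> b - 1" using \<open>t = c # b # a # t'\<close> by auto
    then show ?thesis using valid_swap[OF v] unfolding \<open>t = c # b # a # t'\<close> by metis
  qed
qed auto

lemma top3_top3: "valid t \<Longrightarrow> top3 (top3 t) = t"
proof (cases t rule: top3.cases)
  case (1 c b a t')
  assume "valid t"
  then have "a \<noteq> b" "b \<noteq> c" "a \<noteq> c" using valid3_neq 1 by blast+
  then show ?thesis using 1 by (simp add: not_less) 
qed simp_all

lemma dual_equiv_valid: "valid t \<Longrightarrow> valid (dual_equiv i t) \<and> shape (dual_equiv i t) = shape t"
proof (induction t)
  case (Cons c t)
  show ?case
  proof (cases "length t = i")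
    case True
    then show ?thesis using top3_valid[OF Cons.prems] by (metis dual_equiv.simps(2))
  qed (use Cons shape_Cons_cong[of "dual_equiv i t" t] in simp)
qed auto

text \<open>The condition on \<open>asc\<close> is the one under which axiom 1 provides an edge of
  color \<open>i\<close>, so that these walks can be lifted to the graph.\<close>

fun dual_equiv_walk :: "int list \<Rightarrow> nat list \<Rightarrow> int list \<Rightarrow> bool" where
  "dual_equiv_walk t [] t' \<longleftrightarrow> t = t'"
| "dual_equiv_walk t (i # cs) t' \<longleftrightarrow> asc (i - 1) t \<noteq> asc i t \<and> dual_equiv_walk (dual_equiv i t) cs t'"

lemma dual_equiv_walk_append: "dual_equiv_walk t (cs @ cs') t'' \<longleftrightarrow> (\<exists>t'. dual_equiv_walk t cs t' \<and> dual_equiv_walk t' cs' t'')"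
  by (induction cs arbitrary: t) auto

lemma dual_equiv_walk_app:
  "dual_equiv_walk t cs t' \<Longrightarrow> set cs \<subseteq> {2..<length t} \<Longrightarrow> dual_equiv_walk (u @ t) cs (u @ t')"
proof (induction cs arbitrary: t)
  case (Cons i cs)
  have "asc j (u @ t) = asc j t" if "j < length t" for j
    using that by (induction u) auto
  moreover have "dual_equiv i (u @ t) = u @ dual_equiv i t" if "i < length t"
    using that by (induction u) auto
  ultimately show ?case using Cons by auto
qed auto

text \<open>If the largest letters sit in different corners, the walk is led through the arrangement
  of \<open>two_corners\<close>, where a single move exchanges them; the stretches before and after
  it move smaller letters only and come from the induction hypothesis.\<close>

lemma dual_equiv_walk_connected:
  assumes "valid t" "valid t'" "length t = length t'" "shape t = shape t'"
  shows "\<exists>cs. set cs \<subseteq> {2..<length t} \<and> dual_equiv_walk t cs t'"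
  using assms
proof (induction "length t" arbitrary: t t')
  case 0
  then show ?case by (intro exI[of _ "[]"]) auto
next
  case (Suc k)
  then obtain a t1 r t1' where tt: "t = a # t1" "t' = r # t1'" by (metis length_Suc_conv)
  have lens: "length t1 = k" "length t1' = k" using Suc.hyps(2) Suc.prems(3) tt by auto
  \<comment> \<open>The last cell can be taken off the path again, so a sequence and its tail
    determine each other's shape once the head is known.\<close>
  have *: "shape x = (shape (c # x))(c := False, c + 1 := True)" if "valid (c # x)" for c x
    using that by (auto simp: addable_def fun_eq_iff shape.simps(2))
  show ?case
  proof (cases "a = r")
    case True
    then have "shape t1 = shape t1'" using * Suc.prems tt by metis
    then obtain cs where "set cs \<subseteq> {2..<length t1}" "dual_equiv_walk t1 cs t1'"
      using Suc.hyps(1)[of t1 t1'] Suc.prems tt lens by auto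
    then show ?thesis using dual_equiv_walk_app[of t1 cs t1' "[a]"] tt True lens
      by (intro exI[of _ cs]) auto
  next
    case False
    have "removable (shape (a # t1)) r" using Suc.prems tt removable_shape_Cons by metis
    then obtain s t2 where s: "min a r < s" "s < max a r"
      "valid (a # r # s # t2)" "valid (r # a # s # t2)"
      "shape (r # s # t2) = shape t1" "shape (r # a # s # t2) = shape (a # t1)"
      "length t1 = length t2 + 2"
      using two_corners[of a t1 r] False Suc.prems tt by metis
    obtain cs1 where cs1: "set cs1 \<subseteq> {2..<length t1}" "dual_equiv_walk t1 cs1 (r # s # t2)"
      using Suc.hyps(1)[of t1 "r # s # t2"] Suc.prems tt lens s by auto
    have "shape (r # a # s # t2) = shape (r # t1')" using s(6) Suc.prems(4) tt by metis
    then have "shape (a # s # t2) = shape t1'"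
      using *[OF s(4)] *[of r t1'] Suc.prems(2) tt by metis
    then obtain cs2 where cs2: "set cs2 \<subseteq> {2..<length t1}" "dual_equiv_walk (a # s # t2) cs2 t1'"
      using Suc.hyps(1)[of "a # s # t2" t1'] Suc.prems tt lens s by auto
    have "dual_equiv_walk (a # t1) cs1 (a # r # s # t2)" using dual_equiv_walk_app[OF cs1(2), of "[a]"] cs1 by simp
    moreover have "dual_equiv_walk (a # r # s # t2) [k] (r # a # s # t2)"
      using s lens by auto
    moreover have "dual_equiv_walk (r # a # s # t2) cs2 (r # t1')"
      using dual_equiv_walk_app[OF cs2(2), of "[r]"] cs2 s by simp
    ultimately have "dual_equiv_walk t (cs1 @ [k] @ cs2) t'" unfolding dual_equiv_walk_append tt by blast
    then show ?thesis using cs1 cs2 s lens tt by (intro exI[of _ "cs1 @ [k] @ cs2"]) auto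
  qed
qed

section \<open>The axioms of a dual equivalence graph\<close>

lemma walk_append:
  "walk G u cs v \<Longrightarrow> walk G v cs' w \<Longrightarrow> walk G u (cs @ cs') w"
  by (induction cs arbitrary: u) auto

lemma walk_verts: "walk G u cs v \<Longrightarrow> u \<in> verts G \<and> v \<in> verts G"
  by (induction cs arbitrary: u) auto

locale deg =
  fixes n :: nat and G :: "'v sc_graph"
  assumes deg: "dual_equivalence_graph n n G"
begin

abbreviation V :: "'v set" where "V \<equiv> verts G"

text \<open>Unlike \<open>edges\<close>, the relation \<open>E\<close> is empty for colors outside the meaningful range.\<close>

definition E :: "nat \<Rightarrow> 'v \<Rightarrow> 'v \<Rightarrow> bool" where
  "E i u v \<longleftrightarrow> 2 \<le> i \<and> i < n \<and> {u, v} \<in> edges G i"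

definition S :: "'v \<Rightarrow> nat \<Rightarrow> bool" where
  "S v i \<longleftrightarrow> sig G v i = 1"

text \<open>A color \<open>i\<close> moves letters up to \<open>i + 1\<close>, so the colors below
  \<open>k\<close> act on the first \<open>k\<close> letters; these components are to become
  standard graphs on \<open>k\<close> letters.\<close>

definition comp :: "nat \<Rightarrow> 'v \<Rightarrow> 'v set" where
  "comp k v = {w. \<exists>cs. set cs \<subseteq> {2..<k} \<and> walk G v cs w}"

lemma E_range: "E i u v \<Longrightarrow> 2 \<le> i \<and> i < n"
  by (simp add: E_def)

lemma E_sym: "E i u v \<longleftrightarrow> E i v u"
  by (simp add: E_def insert_commute)

lemma E_verts: "E i u v \<Longrightarrow> u \<in> V \<and> v \<in> V \<and> u \<noteq> v"
  using deg unfolding E_def dual_equivalence_graph_def sc_graph_of_type_def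
  by (fastforce simp: doubleton_eq_iff)

lemma sig_S: "v \<in> V \<Longrightarrow> 1 \<le> i \<Longrightarrow> i < n \<Longrightarrow> sig G v i = (if S v i then 1 else -1)"
  using deg unfolding S_def dual_equivalence_graph_def sc_graph_of_type_def by force

lemma E_unique: "E i w x \<Longrightarrow> E i w y \<Longrightarrow> x = y"
  using deg E_verts[of i w x] E_verts[of i w y]
  unfolding E_def dual_equivalence_graph_def ax1_def by auto

lemma E_ex: "v \<in> V \<Longrightarrow> 2 \<le> i \<Longrightarrow> i < n \<Longrightarrow> (\<exists>x. E i v x) \<longleftrightarrow> S v (i - 1) \<noteq> S v i"
proof -
  assume a: "v \<in> V" "2 \<le> i" "i < n"
  then have "(sig G v (i - 1) = - sig G v i) = (\<exists>x\<in>V. {v, x} \<in> edges G i)"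
    using deg unfolding dual_equivalence_graph_def ax1_def by auto
  moreover have "sig G v (i - 1) = - sig G v i \<longleftrightarrow> S v (i - 1) \<noteq> S v i"
    using sig_S[of v i] sig_S[of v "i - 1"] a by auto
  ultimately show ?thesis using E_verts unfolding E_def using a by blast
qed

lemma E_flip: "E i v x \<Longrightarrow> S x i \<longleftrightarrow> \<not> S v i" "E i v x \<Longrightarrow> S x (i - 1) \<longleftrightarrow> \<not> S v (i - 1)"
  "E i v x \<Longrightarrow> S v (i - 1) \<longleftrightarrow> \<not> S v i"
proof -
  assume e: "E i v x"
  then have "\<forall>j\<in>{i - 1, i}. sig G v j = - sig G x j"
    using deg unfolding E_def dual_equivalence_graph_def ax2_def by auto
  moreover have "Suc 0 \<le> i - Suc 0" "i - Suc 0 < n" using E_range[OF e] by auto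
  ultimately show "S x i \<longleftrightarrow> \<not> S v i" "S x (i - 1) \<longleftrightarrow> \<not> S v (i - 1)"
    using sig_S[of v i] sig_S[of x i] sig_S[of v "i - 1"] sig_S[of x "i - 1"] E_range[OF e] E_verts[OF e]
    by (auto split: if_splits)
  show "S v (i - 1) \<longleftrightarrow> \<not> S v i" using E_ex[of v i] E_range[OF e] E_verts[OF e] e by blast
qed

lemma E_far: "E i v x \<Longrightarrow> 1 \<le> h \<Longrightarrow> h < n \<Longrightarrow> h < i - 2 \<or> i + 1 < h \<Longrightarrow> S x h = S v h"
proof -
  assume "E i v x" "1 \<le> h" "h < n" "h < i - 2 \<or> i + 1 < h"
  moreover from this have "\<forall>h\<in>{1..<n}. h < i - 2 \<or> h > i + 1 \<longrightarrow> sig G v h = sig G x h"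
    using deg unfolding E_def dual_equivalence_graph_def ax2_def by (meson atLeastLessThan_iff)
  ultimately have "sig G v h = sig G x h" by auto
  then show ?thesis by (simp add: S_def)
qed

lemma E_near_above:
  assumes e: "E i v x" and "i + 1 < n" "S x (i + 1) \<noteq> S v (i + 1)"
  shows "S v (i + 1) \<noteq> S v i"
proof -
  have "i + 1 \<in> {1..<n} \<and> sig G v (i + 1) = - sig G x (i + 1) \<longrightarrow> sig G v (i + 1) = - sig G v i"
    using deg e unfolding E_def dual_equivalence_graph_def ax3_def by auto
  then show ?thesis
    using sig_S[of v i] sig_S[of v "i + 1"] sig_S[of x "i + 1"] E_range[OF e] E_verts[OF e] assms
    by (auto split: if_splits)
qed

lemma E_near_below:
  assumes e: "E i v x" and "3 \<le> i" "S x (i - 2) \<noteq> S v (i - 2)"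
  shows "S v (i - 2) \<noteq> S v (i - 1)"
proof -
  have "i - 2 \<in> {1..<n} \<and> sig G v (i - 2) = - sig G x (i - 2) \<longrightarrow> sig G v (i - 2) = - sig G v (i - 1)"
    using deg e unfolding E_def dual_equivalence_graph_def ax3_def by auto
  moreover have "Suc 0 \<le> i - Suc 0" "i - Suc 0 < n" "Suc 0 \<le> i - 2" "i - 2 < n"
    using E_range[OF e] assms(2) by auto
  ultimately show ?thesis
    using sig_S[of v "i - 1"] sig_S[of v "i - 2"] sig_S[of x "i - 2"] E_range[OF e] E_verts[OF e] assms
    by (auto split: if_splits)
qed

lemma E_commute:
  assumes "E i w x" "E j x y" "i + 3 \<le> j \<or> j + 3 \<le> i"
  shows "\<exists>v. E j w v \<and> E i v y"
proof -
  have "\<bar>int i - int j\<bar> \<ge> 3" using assms(3) by auto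
  moreover have "i \<in> {2..<n}" "j \<in> {2..<n}" using assms E_range by auto
  ultimately show ?thesis
    using deg assms unfolding E_def dual_equivalence_graph_def ax5_def by blast
qed

section \<open>Components of two and three consecutive colors\<close>

lemma component_ex:
  assumes "v \<in> V"
  shows "\<exists>W\<in>components G C. v \<in> W"
proof
  show "{w. \<exists>cs. set cs \<subseteq> C \<and> walk G v cs w} \<in> components G C"
    using assms unfolding components_def by auto
  show "v \<in> {w. \<exists>cs. set cs \<subseteq> C \<and> walk G v cs w}"
    using assms by (auto intro!: exI[of _ "[]"])
qed

lemma component_closed:
  assumes "W \<in> components G C" "u \<in> W" "c \<in> C" "E c u x"
  shows "x \<in> W"
proof -
  obtain v cs where "W = {w. \<exists>cs. set cs \<subseteq> C \<and> walk G v cs w}" "set cs \<subseteq> C" "walk G v cs u"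
    using assms unfolding components_def by blast
  moreover have "walk G u [c] x" using assms E_verts[of c u x] by (auto simp: E_def)
  ultimately show ?thesis using walk_append[of G v cs u "[c]" x] assms(3)
    by (auto intro!: exI[of _ "cs @ [c]"])
qed

lemma colored_graph_is_E:
  assumes "colored_graph_is G C W vs es" "W \<in> components G C" "C \<subseteq> {2..<n}"
    "u \<in> W" "c \<in> C"
  shows "E c u x \<longleftrightarrow> x \<in> W \<and> (c, {u, x}) \<in> es"
  using assms component_closed[OF assms(2,4,5), of x] unfolding colored_graph_is_def E_def
  by fastforce

text \<open>Only in the path on three vertices does a vertex have different neighbors in the two
  colors, and then its neighbors are the ends of the path.\<close>

lemma two_color:
  assumes "3 \<le> i" "E i u x" "E (i - 1) u y" "x \<noteq> y"
  shows "\<not> E (i - 1) x z" "\<not> E i y z"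
proof -
  have n: "i < n" and u: "u \<in> V" using assms E_range E_verts by auto
  obtain W where W: "W \<in> components G {i - 1, i}" "u \<in> W" using component_ex u by blast
  have C: "{i - 1, i} \<subseteq> {2..<n}" using assms n by auto
  have ne: "i - 1 \<noteq> i" using assms by auto
  have xy: "x \<in> W" "y \<in> W" using component_closed W assms by blast+
  let ?is = "colored_graph_is G {i - 1, i} W"
  have "(\<exists>a. ?is [a] {}) \<or> (\<exists>a b c. ?is [a, b, c] {(i - 1, {a, b}), (i, {b, c})}) \<or>
        (\<exists>a b. ?is [a, b] {(i - 1, {a, b}), (i, {a, b})})"
    using deg W assms(1) n unfolding dual_equivalence_graph_def ax4_def Let_def by auto
  then consider a where "?is [a] {}" | a b c where "?is [a, b, c] {(i - 1, {a, b}), (i, {b, c})}"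
    | a b where "?is [a, b] {(i - 1, {a, b}), (i, {a, b})}" by blast
  then have "\<not> E (i - 1) x z \<and> \<not> E i y z"
  proof cases
    case 1
    note e = colored_graph_is_E[OF 1 W(1) C]
    show ?thesis using assms(2) e[OF W(2)] by auto
  next
    case (2 a b c)
    note e = colored_graph_is_E[OF 2 W(1) C]
    have d: "distinct [a, b, c]" "W = {a, b, c}"
      using 2 unfolding colored_graph_is_def by auto
    have f0: "E (i - 1) p q \<longleftrightarrow> (p, q) \<in> {(a, b), (b, a)}" if "p \<in> W" for p q
      using e[OF that, of "i - 1" q] d(2) ne ne[symmetric] by (auto simp: doubleton_eq_iff)
    have f1: "E i p q \<longleftrightarrow> (p, q) \<in> {(b, c), (c, b)}" if "p \<in> W" for p q
      using e[OF that, of "i" q] d(2) ne ne[symmetric] by (auto simp: doubleton_eq_iff)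
    show ?thesis using assms(2-4) d(1) xy W(2) by (auto simp: f0[unfolded One_nat_def] f1[unfolded One_nat_def])
  next
    case (3 a b)
    note e = colored_graph_is_E[OF 3 W(1) C]
    have d: "distinct [a, b]" "W = {a, b}"
      using 3 unfolding colored_graph_is_def by auto
    have f0: "E (i - 1) p q \<longleftrightarrow> (p, q) \<in> {(a, b), (b, a)}" if "p \<in> W" for p q
      using e[OF that, of "i - 1" q] d(2) ne ne[symmetric] by (auto simp: doubleton_eq_iff)
    have f1: "E i p q \<longleftrightarrow> (p, q) \<in> {(a, b), (b, a)}" if "p \<in> W" for p q
      using e[OF that, of "i" q] d(2) ne ne[symmetric] by (auto simp: doubleton_eq_iff)
    show ?thesis using assms(2-4) d(1) xy W(2) by (auto simp: f0[unfolded One_nat_def] f1[unfolded One_nat_def])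
  qed
  then show "\<not> E (i - 1) x z" "\<not> E i y z" by auto
qed

text \<open>The single vertex is recorded only as the absence of edges of color
  \<open>i - 2\<close>; the lemmas below start from such an edge, which rules this case out at
  once.\<close>

lemma three_color_cases:
  assumes "4 \<le> i" "i < n" "W \<in> components G {i - 2, i - 1, i}" "u \<in> W"
  obtains "\<And>v x. v \<in> W \<Longrightarrow> \<not> E (i - 2) v x"
   | a b c d where "distinct [a, b, c, d]"
       "\<And>v x. v \<in> W \<Longrightarrow> E (i - 2) v x \<longleftrightarrow> (v, x) \<in> {(a, b), (b, a)}"
       "\<And>v x. v \<in> W \<Longrightarrow> E (i - 1) v x \<longleftrightarrow> (v, x) \<in> {(b, c), (c, b)}"
       "\<And>v x. v \<in> W \<Longrightarrow> E i v x \<longleftrightarrow> (v, x) \<in> {(c, d), (d, c)}"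
   | a b c d e where "distinct [a, b, c, d, e]"
       "\<And>v x. v \<in> W \<Longrightarrow> E (i - 2) v x \<longleftrightarrow> (v, x) \<in> {(a, b), (b, a), (c, d), (d, c)}"
       "\<And>v x. v \<in> W \<Longrightarrow> E (i - 1) v x \<longleftrightarrow> (v, x) \<in> {(a, b), (b, a), (d, e), (e, d)}"
       "\<And>v x. v \<in> W \<Longrightarrow> E i v x \<longleftrightarrow> (v, x) \<in> {(b, c), (c, b), (d, e), (e, d)}"
   | u v w x y z where "distinct [u, v, w, x, y, z]"
       "\<And>a b. a \<in> W \<Longrightarrow> E (i - 2) a b \<longleftrightarrow> (a, b) \<in> {(v, w), (w, v), (x, y), (y, x)}"
       "\<And>a b. a \<in> W \<Longrightarrow> E (i - 1) a b \<longleftrightarrow> (a, b) \<in> {(u, v), (v, u), (y, z), (z, y)}"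
       "\<And>a b. a \<in> W \<Longrightarrow> E i a b \<longleftrightarrow> (a, b) \<in> {(v, x), (x, v), (w, y), (y, w)}"
proof -
  have C: "{i - 2, i - 1, i} \<subseteq> {2..<n}" using assms by auto
  have ne: "i - 1 \<noteq> i" "i - 2 \<noteq> i" "i - 2 \<noteq> i - 1" using assms by auto
  let ?is = "colored_graph_is G {i - 2, i - 1, i} W"
  have "(\<exists>a. ?is [a] {}) \<or>
        (\<exists>a b c d. ?is [a, b, c, d] {(i - 2, {a, b}), (i - 1, {b, c}), (i, {c, d})}) \<or>
        (\<exists>a b c d e. ?is [a, b, c, d, e]
           {(i - 2, {a, b}), (i - 1, {a, b}), (i, {b, c}), (i - 2, {c, d}),
            (i - 1, {d, e}), (i, {d, e})}) \<or>
        (\<exists>u v w x y z. ?is [u, v, w, x, y, z]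
           {(i - 1, {u, v}), (i - 2, {v, w}), (i, {v, x}), (i, {w, y}),
            (i - 2, {x, y}), (i - 1, {y, z})})"
    using deg assms unfolding dual_equivalence_graph_def ax4_def Let_def by auto
  then consider a where "?is [a] {}"
    | a b c d where "?is [a, b, c, d] {(i - 2, {a, b}), (i - 1, {b, c}), (i, {c, d})}"
    | a b c d e where "?is [a, b, c, d, e]
           {(i - 2, {a, b}), (i - 1, {a, b}), (i, {b, c}), (i - 2, {c, d}),
            (i - 1, {d, e}), (i, {d, e})}"
    | u v w x y z where "?is [u, v, w, x, y, z]
           {(i - 1, {u, v}), (i - 2, {v, w}), (i, {v, x}), (i, {w, y}),
            (i - 2, {x, y}), (i - 1, {y, z})}" by metis
  then show thesis
  proof cases
    case 1
    then show ?thesis using colored_graph_is_E[OF 1 assms(3) C] that(1) by simp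
  next
    case (2 a b c d)
    note e = colored_graph_is_E[OF 2 assms(3) C]
    have d: "distinct [a, b, c, d]" "W = {a, b, c, d}"
      using 2 unfolding colored_graph_is_def by auto
    have f0: "E (i - 2) p q \<longleftrightarrow> (p, q) \<in> {(a, b), (b, a)}" if "p \<in> W" for p q
      using e[OF that, of "i - 2" q] d(2) ne ne[symmetric] by (auto simp: doubleton_eq_iff)
    have f1: "E (i - 1) p q \<longleftrightarrow> (p, q) \<in> {(b, c), (c, b)}" if "p \<in> W" for p q
      using e[OF that, of "i - 1" q] d(2) ne ne[symmetric] by (auto simp: doubleton_eq_iff)
    have f2: "E i p q \<longleftrightarrow> (p, q) \<in> {(c, d), (d, c)}" if "p \<in> W" for p q
      using e[OF that, of "i" q] d(2) ne ne[symmetric] by (auto simp: doubleton_eq_iff)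
    show ?thesis by (rule that(2)[OF d(1) f0 f1 f2])
  next
    case (3 a b c d e)
    note e = colored_graph_is_E[OF 3 assms(3) C]
    have d: "distinct [a, b, c, d, e]" "W = {a, b, c, d, e}"
      using 3 unfolding colored_graph_is_def by auto
    have f0: "E (i - 2) p q \<longleftrightarrow> (p, q) \<in> {(a, b), (b, a), (c, d), (d, c)}" if "p \<in> W" for p q
      using e[OF that, of "i - 2" q] d(2) ne ne[symmetric] by (auto simp: doubleton_eq_iff)
    have f1: "E (i - 1) p q \<longleftrightarrow> (p, q) \<in> {(a, b), (b, a), (d, e), (e, d)}" if "p \<in> W" for p q
      using e[OF that, of "i - 1" q] d(2) ne ne[symmetric] by (auto simp: doubleton_eq_iff)
    have f2: "E i p q \<longleftrightarrow> (p, q) \<in> {(b, c), (c, b), (d, e), (e, d)}" if "p \<in> W" for p q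
      using e[OF that, of "i" q] d(2) ne ne[symmetric] by (auto simp: doubleton_eq_iff)
    show ?thesis by (rule that(3)[OF d(1) f0 f1 f2])
  next
    case (4 u v w x y z)
    note e = colored_graph_is_E[OF 4 assms(3) C]
    have d: "distinct [u, v, w, x, y, z]" "W = {u, v, w, x, y, z}"
      using 4 unfolding colored_graph_is_def by auto
    have f0: "E (i - 2) p q \<longleftrightarrow> (p, q) \<in> {(v, w), (w, v), (x, y), (y, x)}" if "p \<in> W" for p q
      using e[OF that, of "i - 2" q] d(2) ne ne[symmetric] by (auto simp: doubleton_eq_iff)
    have f1: "E (i - 1) p q \<longleftrightarrow> (p, q) \<in> {(u, v), (v, u), (y, z), (z, y)}" if "p \<in> W" for p q
      using e[OF that, of "i - 1" q] d(2) ne ne[symmetric] by (auto simp: doubleton_eq_iff)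
    have f2: "E i p q \<longleftrightarrow> (p, q) \<in> {(v, x), (x, v), (w, y), (y, w)}" if "p \<in> W" for p q
      using e[OF that, of "i" q] d(2) ne ne[symmetric] by (auto simp: doubleton_eq_iff)
    show ?thesis by (rule that(4)[OF d(1) f0 f1 f2])
  qed
qed

text \<open>A vertex that meets all three colors, with the edge of color \<open>i - 1\<close>
  parallel to neither of the others, exists only in the six-vertex graph, where the colors
  \<open>i - 2\<close> and \<open>i\<close> form a square through it.\<close>

lemma three_color_square:
  assumes "4 \<le> i" "E (i - 2) v w" "E i v x" "E (i - 1) v u" "u \<noteq> x" "u \<noteq> w"
  shows "\<exists>y. E i w y \<and> E (i - 2) x y"
proof -
  have n: "i < n" and v: "v \<in> V" using assms E_range E_verts by auto
  obtain W where W: "W \<in> components G {i - 2, i - 1, i}" "v \<in> W" using component_ex v by blast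
  have xy: "x \<in> W" "w \<in> W" using component_closed W assms by blast+
  show ?thesis
    by (rule three_color_cases[OF assms(1) n W])
      (use assms(2-) W xy in \<open>(simp; metis)+\<close>)
qed

text \<open>A double edge of colors \<open>i - 1\<close> and \<open>i\<close> occurs only in the
  five-vertex graph, which is read here from this end to the double edge at the other;
  \<open>three_color_double_down\<close> reads it backwards.\<close>

lemma three_color_double_up:
  assumes "4 \<le> i" "E (i - 2) c d" "E (i - 1) d e" "E i d e" "E i c b"
  shows "\<exists>a. E (i - 2) b a \<and> E (i - 1) b a"
proof -
  have n: "i < n" and v: "c \<in> V" using assms E_range E_verts by auto
  obtain W where W: "W \<in> components G {i - 2, i - 1, i}" "c \<in> W" using component_ex v by blast
  have xy: "d \<in> W" "b \<in> W" using component_closed W assms by blast+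
  show ?thesis
    by (rule three_color_cases[OF assms(1) n W])
      (use assms(2-) W xy in \<open>(simp; metis)+\<close>)
qed

lemma three_color_double_down:
  assumes "4 \<le> i" "E (i - 2) b a" "E (i - 1) b a" "E i b c"
  shows "\<exists>d e. E (i - 2) c d \<and> E (i - 1) d e \<and> E i d e"
proof -
  have n: "i < n" and v: "b \<in> V" using assms E_range E_verts by auto
  obtain W where W: "W \<in> components G {i - 2, i - 1, i}" "b \<in> W" using component_ex v by blast
  have xy: "a \<in> W" "c \<in> W" using component_closed W assms by blast+
  have d: "d \<in> W" if "E (i - 2) c d" for d using component_closed[OF W(1) xy(2) _ that] by auto
  show ?thesis
    by (rule three_color_cases[OF assms(1) n W])
      (use assms(2-) W xy d in \<open>(simp; metis)+\<close>)
qed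

end

lemma valid_appD: "valid (u @ t) \<Longrightarrow> valid t"
  by (induction u) auto

lemma dual_equiv_app: "i < length t \<Longrightarrow> dual_equiv i (u @ t) = u @ dual_equiv i t"
  by (induction u) auto

lemma walk_rev: "walk G u cs v \<Longrightarrow> walk G v (rev cs) u"
proof (induction cs arbitrary: u)
  case (Cons c cs)
  then obtain x where "{u, x} \<in> edges G c" "walk G x cs v" "u \<in> verts G" by auto
  moreover from this have "walk G x [c] u" by (auto simp: insert_commute dest: walk_verts)
  ultimately show ?case using Cons.IH walk_append by fastforce
qed auto

context deg
begin

lemma comp_refl: "v \<in> V \<Longrightarrow> v \<in> comp k v"
  unfolding comp_def by (auto intro: exI[of _ "[]"])

lemma comp_V: "x \<in> comp k v \<Longrightarrow> x \<in> V \<and> v \<in> V"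
  unfolding comp_def using walk_verts by fastforce

lemma comp_sym: "x \<in> comp k v \<Longrightarrow> v \<in> comp k x"
proof -
  assume "x \<in> comp k v"
  then obtain cs where "set cs \<subseteq> {2..<k}" "walk G v cs x" unfolding comp_def by blast
  then have "set (rev cs) \<subseteq> {2..<k} \<and> walk G x (rev cs) v" using walk_rev by simp
  then show ?thesis unfolding comp_def by blast
qed

lemma comp_trans: "x \<in> comp k v \<Longrightarrow> y \<in> comp k x \<Longrightarrow> y \<in> comp k v"
proof -
  assume "x \<in> comp k v" "y \<in> comp k x"
  then obtain cs cs' where "set cs \<subseteq> {2..<k}" "walk G v cs x" "set cs' \<subseteq> {2..<k}" "walk G x cs' y"
    unfolding comp_def by blast
  then have "set (cs @ cs') \<subseteq> {2..<k} \<and> walk G v (cs @ cs') y" using walk_append by auto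
  then show ?thesis unfolding comp_def by blast
qed

lemma comp_eq: "x \<in> comp k v \<Longrightarrow> comp k x = comp k v"
  using comp_sym comp_trans by blast

lemma comp_mono: "x \<in> comp k v \<Longrightarrow> k \<le> k' \<Longrightarrow> x \<in> comp k' v"
  unfolding comp_def by fastforce

lemma comp_E: "E i v x \<Longrightarrow> i < k \<Longrightarrow> x \<in> comp k v"
  using E_verts[of i v x] E_range[of i v x] unfolding comp_def E_def
  by (auto intro!: exI[of _ "[i]"])

lemma walk_Cons_E: "walk G v (i # cs) x \<Longrightarrow> 2 \<le> i \<Longrightarrow> i < n \<Longrightarrow> \<exists>y. E i v y \<and> walk G y cs x"
  by (auto simp: E_def)

lemma walk_ConsI: "E i v y \<Longrightarrow> walk G y cs x \<Longrightarrow> walk G v (i # cs) x"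
  using E_verts[of i v y] by (auto simp: E_def)

lemma comp_induct [consumes 2, case_names refl step]:
  assumes "x \<in> comp k v" "k \<le> n" "P v"
    "\<And>i y z. E i y z \<Longrightarrow> i < k \<Longrightarrow> y \<in> comp k v \<Longrightarrow> P y \<Longrightarrow> P z"
  shows "P x"
proof -
  have "P x" if "walk G y cs x" "set cs \<subseteq> {2..<k}" "y \<in> comp k v" "P y" for cs y
    using that
  proof (induction cs arbitrary: y)
    case (Cons i cs)
    then obtain z where z: "E i y z" "walk G z cs x" using walk_Cons_E[of y i cs x] assms(2) by auto
    have "z \<in> comp k v" using comp_E[OF z(1)] Cons.prems comp_trans by auto
    then show ?case using Cons.IH[OF z(2)] assms(4)[OF z(1)] Cons.prems by auto
  qed auto
  then show ?thesis using assms(1,3) comp_refl comp_V[OF assms(1)] unfolding comp_def by blast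
qed

section \<open>Labelling the vertices\<close>

text \<open>A candidate has to explain the signs of index \<open>m\<close> on the whole component,
  since at \<open>v\<close> alone several addable cells may fit. For \<open>m = 0\<close> there is
  no sign to explain.\<close>

definition next_content :: "nat \<Rightarrow> ('v \<Rightarrow> int list) \<Rightarrow> 'v \<Rightarrow> int \<Rightarrow> bool" where
  "next_content m f v c \<longleftrightarrow>
     addable (shape (f v)) c \<and> (0 < m \<longrightarrow> (\<forall>u\<in>comp m v. S u m \<longleftrightarrow> hd (f u) < c))"

primrec label :: "nat \<Rightarrow> 'v \<Rightarrow> int list" where
  "label 0 = (\<lambda>v. [])"
| "label (Suc m) = (\<lambda>v. (SOME c. next_content m (label m) v c) # label m v)"

declare label.simps(2) [simp del]

lemma length_label [simp]: "length (label m v) = m"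
  by (induction m) (auto simp: label.simps)

lemma label_Suc_eq: "label (Suc m) v = hd (label (Suc m) v) # label m v"
  by (simp add: label.simps)

text \<open>
  The letters \<open>1, \<dots>, M\<close> are placed, but edges are only known to act correctly for colors below \<open>m\<close>;
  the interesting cases are \<open>M = m\<close> and \<open>M = m + 1\<close>.
\<close>

definition partial_label :: "nat \<Rightarrow> nat \<Rightarrow> bool" where
  "partial_label M m \<longleftrightarrow> m \<le> M \<and> m \<le> n \<and>
     (\<forall>v\<in>V. valid (label M v) \<and> (\<forall>i. 1 \<le> i \<and> i < M \<longrightarrow> S v i = asc i (label M v))) \<and>
     (\<forall>i v x. E i v x \<longrightarrow> i < m \<longrightarrow> label M x = dual_equiv i (label M v))"

text \<open>The induction hypothesis. The second clause lets vertices be identified by their labels.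
  In the last one, a color from \<open>m + 2\<close> on should move only letters above
  \<open>m\<close>; this is what axiom 5 yields.\<close>

definition labelling :: "nat \<Rightarrow> bool" where
  "labelling m \<longleftrightarrow> partial_label m m \<and> (\<forall>v\<in>V. \<forall>x\<in>comp m v. label m v = label m x \<longrightarrow> v = x) \<and>
     (\<forall>i v x. E i v x \<longrightarrow> m + 2 \<le> i \<longrightarrow> label m x = label m v)"

lemma partial_labelD:
  assumes "partial_label M m"
  shows "v \<in> V \<Longrightarrow> valid (label M v)" "v \<in> V \<Longrightarrow> 1 \<le> i \<Longrightarrow> i < M \<Longrightarrow> S v i = asc i (label M v)"
    "E i v x \<Longrightarrow> i < m \<Longrightarrow> label M x = dual_equiv i (label M v)" "m \<le> M" "m \<le> n"
  using assms unfolding partial_label_def by blast+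

lemma labellingD:
  assumes "labelling m"
  shows "partial_label m m" "x \<in> comp m v \<Longrightarrow> label m v = label m x \<Longrightarrow> v = x"
    "E i v x \<Longrightarrow> m + 2 \<le> i \<Longrightarrow> label m x = label m v"
  using assms comp_V[of x m v] unfolding labelling_def by blast+

section \<open>Labels along walks\<close>

lemma partial_label_shape:
  assumes "partial_label M m" "x \<in> comp k v" "k \<le> m"
  shows "shape (label M x) = shape (label M v)"
proof -
  have "k \<le> n" using assms partial_labelD(5) by fastforce
  with assms(2) show ?thesis
  proof (induction rule: comp_induct)
    case (step i y z)
    then show ?case using partial_labelD(3)[OF assms(1) step(1)] partial_labelD(1)[OF assms(1)] dual_equiv_valid E_verts assms(3)
      by (metis less_le_trans)
  qed simp
qed

lemma partial_label_app:
  assumes "partial_label M m" "x \<in> comp k v" "k \<le> m" "label M v = u @ t" "length t = k"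
  shows "\<exists>t'. label M x = u @ t' \<and> length t' = k"
proof -
  have "k \<le> n" using assms partial_labelD(5) by fastforce
  with assms(2) show ?thesis
  proof (induction rule: comp_induct)
    case (step i y z)
    then show ?case using partial_labelD(3)[OF assms(1) step(1)] assms(3) dual_equiv_app[of i _ u]
      by (metis length_dual_equiv less_le_trans)
  qed (use assms in simp)
qed

text \<open>The signs agree with \<open>asc\<close>, so axiom 1 supplies an edge for every move of
  the sequence, and this edge acts on the label as that move.\<close>

lemma lift:
  assumes "partial_label M m" "set cs \<subseteq> {2..<m}" "v \<in> V" "dual_equiv_walk (label M v) cs t"
  shows "\<exists>x. walk G v cs x \<and> label M x = t"
  using assms(2-)
proof (induction cs arbitrary: v)
  case (Cons i cs)
  have i: "2 \<le> i" "i < m" using Cons.prems by auto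
  have "S v (i - 1) \<noteq> S v i"
    using Cons.prems partial_labelD(2)[OF assms(1), of v i] partial_labelD(2)[OF assms(1), of v "i - 1"] i
      partial_labelD(4,5)[OF assms(1)] by auto
  then obtain y where y: "E i v y" using E_ex[of v i] Cons.prems(2) i partial_labelD(5)[OF assms(1)] by auto
  have "label M y = dual_equiv i (label M v)" using partial_labelD(3)[OF assms(1) y i(2)] .
  then obtain x where "walk G y cs x" "label M x = t"
    using Cons.IH[of y] Cons.prems E_verts[OF y] by auto
  then show ?case using walk_ConsI[OF y] by blast
qed auto

lemma follow:
  assumes "partial_label M m" "set cs \<subseteq> {2..<m}" "walk G v cs x" "dual_equiv_walk (label M v) cs t"
  shows "label M x = t"
  using assms(2-)
proof (induction cs arbitrary: v)
  case (Cons i cs)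
  have i: "2 \<le> i" "i < m" using Cons.prems by auto
  then obtain y where "E i v y" "walk G y cs x"
    using walk_Cons_E Cons.prems partial_labelD(5)[OF assms(1)] by (meson less_le_trans)
  then show ?case using Cons.IH[of y] Cons.prems partial_labelD(3)[OF assms(1) _ i(2)] by auto
qed auto

text \<open>The colors of the walk are at most \<open>k - 1\<close> and hence differ from
  \<open>i\<close> by at least 3, so axiom 5 fills in one square after the other.\<close>

lemma walk_E_commute:
  assumes "walk G v cs x" "E i v y" "set cs \<subseteq> {2..<k}" "k + 2 \<le> i"
  shows "\<exists>z. E i x z \<and> walk G y cs z"
  using assms
proof (induction cs arbitrary: v y)
  case Nil
  then show ?case using E_verts[of i v y] by auto
next
  case (Cons j cs)
  have "2 \<le> j" "j < n" using Cons.prems E_range[of i v y] by auto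
  then obtain v1 where v1: "E j v v1" "walk G v1 cs x" using walk_Cons_E Cons.prems by blast
  have "j + 3 \<le> i" using Cons.prems by auto
  then obtain y1 where y1: "E j y y1" "E i y1 v1"
    using E_commute[of i y v j v1] Cons.prems(2) v1(1) E_sym by blast
  then obtain z where "E i x z" "walk G y1 cs z" using Cons.IH[OF v1(2), of y1] Cons.prems E_sym by auto
  then show ?case using walk_ConsI[OF y1(1)] by blast
qed

lemma reach:
  assumes "partial_label M m" "k \<le> m" "v \<in> V" "label M v = u @ t" "length t = k"
    "valid t'" "length t' = k" "shape t' = shape t"
  shows "\<exists>x\<in>comp k v. label M x = u @ t'"
proof -
  have "valid t" using partial_labelD(1)[OF assms(1,3)] assms(4) valid_appD by metis
  then obtain cs where cs: "set cs \<subseteq> {2..<k}" "dual_equiv_walk t cs t'"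
    using dual_equiv_walk_connected[of t t'] assms by auto
  then have "dual_equiv_walk (label M v) cs (u @ t')" using dual_equiv_walk_app assms by metis
  then obtain x where "walk G v cs x" "label M x = u @ t'"
    using lift[OF assms(1) _ assms(3)] cs(1) assms(2) by fastforce
  then show ?thesis using cs unfolding comp_def by blast
qed

text \<open>One walk rearranges the letters up to \<open>k\<close> at both ends of the edge, while
  the larger letters, which may differ at the two ends, stay in place. This brings an edge into a
  position where axiom 4 can be evaluated.\<close>

lemma transport:
  assumes "partial_label M m" "k \<le> m" "E i v y" "k + 2 \<le> i" "label M v = u @ t" "label M y = u' @ t" "length t = k"
    "valid t'" "length t' = k" "shape t' = shape t"
  obtains v' y' where "E i v' y'" "v' \<in> comp k v" "y' \<in> comp k y" "label M v' = u @ t'" "label M y' = u' @ t'"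
proof -
  have v: "v \<in> V" using E_verts assms by blast
  have "valid t" using partial_labelD(1)[OF assms(1) v] assms(5) valid_appD by metis
  then obtain cs where cs: "set cs \<subseteq> {2..<k}" "dual_equiv_walk t cs t'"
    using dual_equiv_walk_connected[of t t'] assms by auto
  then have tw: "dual_equiv_walk (label M v) cs (u @ t')" "dual_equiv_walk (label M y) cs (u' @ t')"
    using dual_equiv_walk_app assms by metis+
  have cs': "set cs \<subseteq> {2..<m}" using cs(1) assms(2) by auto
  obtain v' where v': "walk G v cs v'" "label M v' = u @ t'"
    using lift[OF assms(1) cs' v tw(1)] by blast
  obtain y' where y': "E i v' y'" "walk G y cs y'"
    using walk_E_commute[OF v'(1) assms(3) cs(1) assms(4)] by blast
  show ?thesis
    using that[OF y'(1) _ _ v'(2) follow[OF assms(1) cs' y'(2) tw(2)]] v'(1) y'(2) cs(1)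
    unfolding comp_def by blast
qed

section \<open>Existence and uniqueness of the next cell\<close>

lemma next_content_comp:
  assumes "labelling m" "u \<in> comp m v"
  shows "next_content m (label m) u c \<longleftrightarrow> next_content m (label m) v c"
  using partial_label_shape[OF labellingD(1)[OF assms(1)] assms(2)] comp_eq[OF assms(2)]
  unfolding next_content_def by auto

text \<open>A removable corner \<open>r\<close> lies between two candidates. Some vertex of the
  component has the letter \<open>m\<close> at \<open>r\<close>, and the candidates would require
  opposite signs there.\<close>

lemma next_content_unique:
  assumes "labelling m" "v \<in> V" "next_content m (label m) v c" "next_content m (label m) v c'"
  shows "c = c'"
proof -
  have False if a: "next_content m (label m) v c" "next_content m (label m) v c'" "c < c'" for c c'
  proof -
    obtain r where r: "c < r" "r < c'" "removable (shape (label m v)) r"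
      using removable_between a unfolding next_content_def by blast
    have partial_label: "partial_label m m" using labellingD assms by blast
    obtain t0 where t0: "valid (r # t0)" "shape (r # t0) = shape (label m v)" "m = Suc (length t0)"
      using removable_last[OF partial_labelD(1)[OF partial_label assms(2)] r(3)] by auto
    then obtain u where "u \<in> comp m v" "label m u = r # t0"
      using reach[OF partial_label order_refl assms(2), of "[]" "label m v" "r # t0"] by auto
    then show False using a r t0(3) unfolding next_content_def by force
  qed
  then show ?thesis using assms(3,4) by (metis linorder_neqE_linordered_idom)
qed

text \<open>With \<open>m\<close> in the same corner, the smaller letters fill the same shape, so
  colors up to \<open>m - 2\<close> lead from \<open>u\<close> to a vertex with the label of
  \<open>u'\<close>. By injectivity this is \<open>u'\<close>, and by axiom 2 these colors do not
  affect the sign of index \<open>m\<close>.\<close>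

lemma S_last_eq:
  assumes "labelling m" "m < n" "0 < m" "u \<in> comp m v" "u' \<in> comp m v" "hd (label m u) = hd (label m u')"
  shows "S u m \<longleftrightarrow> S u' m"
proof -
  have partial_label: "partial_label m m" using labellingD assms by blast
  obtain k where k: "m = Suc k" using assms(3) by (cases m) auto
  define r where "r = hd (label m u)"
  define t t' where "t = label k u" and "t' = label k u'"
  have u: "label m u = [r] @ t" "label m u' = [r] @ t'"
    using label_Suc_eq[of k u] label_Suc_eq[of k u'] assms(6) by (auto simp: k r_def t_def t'_def)
  have V: "u \<in> V" "u' \<in> V" using assms comp_V by auto
  have sh: "shape (r # t) = shape (r # t')"
    using partial_label_shape[OF partial_label assms(4)] partial_label_shape[OF partial_label assms(5)] u by auto
  have val: "valid (r # t)" "valid (r # t')" using partial_labelD(1)[OF partial_label V(1)] partial_labelD(1)[OF partial_label V(2)] u by auto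
  have "shape t = shape t'"
  proof
    fix x
    have "shape (r # t) x = shape (r # t') x" using sh by simp
    then show "shape t x = shape t' x" using val by (auto simp: shape_Cons addable_def)
  qed
  then obtain z where z: "z \<in> comp k u" "label m z = [r] @ t'"
    using reach[OF partial_label _ V(1) u(1), of k t'] val k by (auto simp: t_def t'_def)
  have "z \<in> comp m u" using comp_mono[OF z(1)] k by auto
  then have "z \<in> comp m u'" using assms(4,5) comp_trans comp_sym by blast
  then have "z = u'" using labellingD(2)[OF assms(1)] z(2) u(2) by metis
  have "S z m = S u m"
    using z(1) order_less_imp_le[OF assms(2)[unfolded k, THEN Suc_lessD]]
  proof (induction rule: comp_induct)
    case (step i y w)
    then show ?case using E_far[OF step(1), of m] assms(2,3) k by auto
  qed simp
  then show ?thesis using \<open>z = u'\<close> by simp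
qed

text \<open>
  The two corners can be exchanged by an edge of color \<open>m - 1\<close> (put \<open>m - 2\<close> in a corner between
  them), and axiom 3 restricts how this edge changes \<open>\<sigma>\<^sub>m\<close>.
\<close>

lemma S_last_mono:
  assumes "labelling m" "m < n" "0 < m" "u \<in> comp m v" "u' \<in> comp m v"
    "hd (label m u) < hd (label m u')" "S u' m"
  shows "S u m"
proof (rule ccontr)
  assume nS: "\<not> S u m"
  have partial_label: "partial_label m m" using labellingD assms by blast
  obtain k where k: "m = Suc k" using assms(3) by (cases m) auto
  define r r' where "r = hd (label m u)" and "r' = hd (label m u')"
  have u: "label m u = r # label k u" "label m u' = r' # label k u'"
    using label_Suc_eq[of k u] label_Suc_eq[of k u'] by (auto simp: k r_def r'_def)
  have V: "u \<in> V" "u' \<in> V" using assms comp_V by auto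
  have sh: "shape (label m u) = shape (label m u')"
    using partial_label_shape[OF partial_label assms(4)] partial_label_shape[OF partial_label assms(5)] by auto
  have "valid (r # label k u)" using partial_labelD(1)[OF partial_label V(1)] u by metis
  moreover have "removable (shape (r # label k u)) r'" using sh u removable_shape_Cons by metis
  moreover have "r' \<noteq> r" using assms(6) r_def r'_def by auto
  ultimately obtain s t2 where s: "min r r' < s" "s < max r r'" "valid (r # r' # s # t2)"
    "shape (r' # s # t2) = shape (label k u)" "length (label k u) = length t2 + 2"
    using two_corners by metis
  obtain w where w: "w \<in> comp m u" "label m w = r # r' # s # t2"
    using reach[OF partial_label order_refl V(1), of "[]" "label m u" "r # r' # s # t2"] s(3,5) k
      shape_Cons_cong[OF s(4), of r] u(1) by auto
  have wV: "w \<in> V" using comp_V w by auto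
  have rr: "r < s" "s < r'" using s(1,2) assms(6) r_def r'_def by auto
  have len: "length t2 + 2 = k" using s(5) by simp
  have Sw: "S w k = False" "S w (k - 1) = True"
    using partial_labelD(2)[OF partial_label wV, of k] partial_labelD(2)[OF partial_label wV, of "k - 1"] w(2) len k rr by auto
  then obtain x where x: "E k w x" using E_ex[OF wV, of k] len assms(2) k by auto
  have lx: "label m x = r' # r # s # t2" using partial_labelD(3)[OF partial_label x] k w(2) len rr by auto
  have "S w m = S u m"
    using S_last_eq[OF assms(1-3), of w v u] comp_trans[OF assms(4) w(1)] assms(4) w(2) r_def by auto
  moreover have "x \<in> comp m v" using comp_E[OF x] k comp_trans[OF assms(4) comp_trans[OF w(1)]] by auto
  then have "S x m = S u' m"
    using S_last_eq[OF assms(1-3), of x v u'] assms(5) lx r'_def by auto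
  ultimately show False using E_near_above[OF x] nS assms(2,7) k Sw by auto
qed

text \<open>By the two preceding lemmas the corners with positive sign, collected in
  \<open>R\<close>, come before all others; the first addable cell after them is the one
  sought.\<close>

lemma next_content_exists:
  assumes "labelling m" "m < n" "v \<in> V"
  shows "\<exists>c. next_content m (label m) v c"
proof (cases "m = 0")
  case True
  then show ?thesis by (intro exI[of _ 0]) (auto simp: next_content_def addable_def)
next
  case False
  then have m: "0 < m" by auto
  have partial_label: "partial_label m m" using labellingD assms by blast
  let ?b = "shape (label m v)"
  define R where "R = {hd (label m u) | u. u \<in> comp m v \<and> S u m}"
  have rem: "removable ?b (hd (label m u))" if "u \<in> comp m v" for u
    using partial_label_shape[OF partial_label that] removable_shape_Cons m
    by (metis gr0_implies_Suc label_Suc_eq order_refl)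
  obtain L where L: "\<forall>k\<le>L. \<not> ?b k" using shape_low by blast
  obtain H where H: "\<forall>k\<ge>H. ?b k" using shape_high by blast
  have bnd: "L < r \<and> r < H" if "r \<in> R" for r
  proof -
    have "removable ?b r" using rem that unfolding R_def by auto
    then show ?thesis using L H unfolding removable_def by (meson linorder_not_less zless_imp_add1_zle
          order_less_imp_le add_increasing2 zero_le_one order_trans)
  qed
  have "R \<subseteq> {L..H}"
  proof
    show "r \<in> {L..H}" if "r \<in> R" for r using bnd[OF that] by simp
  qed
  then have finR: "finite R" by (rule finite_subset) simp
  \<comment> \<open>A vertical step that separates \<open>R\<close> from the other corners: far to
    the northwest if \<open>R\<close> is empty, and just after the last corner of \<open>R\<close>
    otherwise.\<close>
  obtain x where x: "\<not> ?b x" "\<And>r. r \<in> R \<Longrightarrow> r < x"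
     "\<And>r. removable ?b r \<Longrightarrow> r < x \<Longrightarrow> r \<in> R \<or> (\<exists>r'\<in>R. r < r')"
  proof (cases "R = {}")
    case True
    show ?thesis
    proof (rule that[of L])
      show "\<not> ?b L" using L by simp
      show "r \<in> R \<or> (\<exists>r'\<in>R. r < r')" if "removable ?b r" "r < L" for r
        using that L unfolding removable_def by auto
    qed (use True in auto)
  next
    case False
    then have MR: "Max R \<in> R" using finR by auto
    then have "removable ?b (Max R)" using rem unfolding R_def by auto
    then show ?thesis
    proof (intro that[of "Max R + 1"])
      show "r \<in> R \<or> (\<exists>r'\<in>R. r < r')" if "r < Max R + 1" for r
        using that MR by (cases "r = Max R") (auto intro!: bexI[of _ "Max R"])
      show "r < Max R + 1" if "r \<in> R" for r using Max_ge[OF finR that] by auto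
    qed (auto simp: removable_def)
  qed
  have "?b (max H (x + 1))" using H by simp
  \<comment> \<open>All steps from \<open>x\<close> to \<open>c\<close> are vertical, so no
    removable corner lies there and comparison with \<open>c\<close> agrees with comparison with
    \<open>x\<close>.\<close>
  then obtain c where c: "x \<le> c" "\<forall>z. x \<le> z \<and> z \<le> c \<longrightarrow> \<not> ?b z" "?b (c + 1)"
    using first_True[of ?b x "max H (x + 1)"] x(1) by (auto simp: less_max_iff_disj)
  have "S u m \<longleftrightarrow> hd (label m u) < c" if u: "u \<in> comp m v" for u
  proof
    assume "S u m"
    then have "hd (label m u) \<in> R" using u R_def by auto
    then show "hd (label m u) < c" using x(2) c(1) by force
  next
    assume "hd (label m u) < c"
    then have "hd (label m u) < x"
      using c(2) rem[OF u] unfolding removable_def by (meson linorder_not_less less_imp_le)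
    then consider u' where "u' \<in> comp m v" "S u' m" "hd (label m u) = hd (label m u')"
      | u' where "u' \<in> comp m v" "S u' m" "hd (label m u) < hd (label m u')"
      using x(3)[OF rem[OF u]] unfolding R_def by fastforce
    then show "S u m" using S_last_eq[OF assms(1,2) m u] S_last_mono[OF assms(1,2) m u] by cases auto
  qed
  then show ?thesis using c by (intro exI[of _ c]) (auto simp: next_content_def addable_def)
qed

lemma next_content_label:
  assumes "labelling m" "m < n" "v \<in> V"
  shows "next_content m (label m) v (hd (label (Suc m) v))"
  using someI_ex[OF next_content_exists[OF assms]] by (simp add: label.simps(2))

lemma label_last_comp:
  assumes "labelling m" "m < n" "x \<in> comp m v"
  shows "hd (label (Suc m) x) = hd (label (Suc m) v)"
  using next_content_label[OF assms(1,2)] next_content_comp[OF assms(1,3)] next_content_unique[OF assms(1)] comp_V[OF assms(3)]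
  by blast

lemma partial_label_Suc:
  assumes "labelling m" "m < n"
  shows "partial_label (Suc m) m"
proof -
  have partial_label: "partial_label m m" using labellingD assms by blast
  have "valid (label (Suc m) v)" if "v \<in> V" for v
    using next_content_label[OF assms that] partial_labelD(1)[OF partial_label that] label_Suc_eq[of m v] unfolding next_content_def
    by (metis valid.simps(2))
  moreover have "S v i = asc i (label (Suc m) v)" if "v \<in> V" "1 \<le> i" "i < Suc m" for v i
  proof (cases "i = m")
    case True
    then have "S v m \<longleftrightarrow> hd (label m v) < hd (label (Suc m) v)"
      using next_content_label[OF assms that(1)] that comp_refl unfolding next_content_def by auto
    then show ?thesis using True by (subst label_Suc_eq) simp
  next
    case False
    then show ?thesis using partial_labelD(2)[OF partial_label that(1,2)] that by (subst label_Suc_eq) simp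
  qed
  moreover have "label (Suc m) x = dual_equiv i (label (Suc m) v)" if "E i v x" "i < m" for i v x
    using label_last_comp[OF assms comp_E[OF that]] partial_labelD(3)[OF partial_label that] that(2)
    by (subst (1 2) label_Suc_eq) simp
  ultimately show ?thesis using partial_labelD(5)[OF partial_label] unfolding partial_label_def by auto
qed

text \<open>The candidate at \<open>v\<close> fits at \<open>x\<close> as well: axiom 5 carries the
  edge over the component of \<open>x\<close>, and it changes neither the first \<open>m\<close>
  letters nor, as \<open>m < i - 2\<close>, the sign of index \<open>m\<close>.\<close>

lemma label_far_Suc:
  assumes "labelling m" "E i v x" "m + 3 \<le> i"
  shows "label (Suc m) x = label (Suc m) v"
proof -
  have n: "m < n" and V: "v \<in> V" "x \<in> V" using assms E_range E_verts by fastforce+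
  have l: "label m x = label m v" using labellingD(3)[OF assms(1,2)] assms(3) by auto
  let ?c = "hd (label (Suc m) v)"
  have g: "next_content m (label m) v ?c" using next_content_label[OF assms(1) n V(1)] .
  have "next_content m (label m) x ?c"
    unfolding next_content_def
  proof (intro conjI impI ballI)
    show "addable (shape (label m x)) ?c" using g l unfolding next_content_def by auto
    fix u assume m: "0 < m" and "u \<in> comp m x"
    then obtain cs where cs: "walk G x cs u" "set cs \<subseteq> {2..<m}" unfolding comp_def by auto
    then obtain u' where u': "E i u u'" "walk G v cs u'"
      using walk_E_commute[OF cs(1) _ cs(2), of i v] assms(2,3) E_sym by auto
    then have "u' \<in> comp m v" using cs(2) unfolding comp_def by blast
    then have "S u' m \<longleftrightarrow> hd (label m u') < ?c" using g m unfolding next_content_def by blast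
    moreover have "label m u' = label m u" using labellingD(3)[OF assms(1) u'(1)] assms(3) by auto
    moreover have "S u' m = S u m" using E_far[OF u'(1), of m] m n assms(3) by auto
    ultimately show "S u m \<longleftrightarrow> hd (label m u) < ?c" by simp
  qed
  then have "hd (label (Suc m) x) = ?c" using next_content_unique[OF assms(1) V(2) next_content_label[OF assms(1) n V(2)]] by simp
  then show ?thesis using l label_Suc_eq by metis
qed

end

section \<open>Edges of the largest color\<close>

lemma set_below_top: "set cs \<subseteq> {2..m} \<Longrightarrow> m \<notin> set cs \<Longrightarrow> set cs \<subseteq> {2..<m::nat}"
  by (auto simp: subset_iff le_less)

lemma walk_split: "walk G u (cs @ cs') w \<Longrightarrow> \<exists>v. walk G u cs v \<and> walk G v cs' w"
proof (induction cs arbitrary: u)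
  case (Cons c cs)
  then show ?case by simp blast
qed (auto dest: walk_verts)

context deg
begin

lemma label_tl: "label m v = tl (label (Suc m) v)"
  by (subst label_Suc_eq) simp

text \<open>
  By axiom 5 the letter \<open>m - 2\<close> may be moved to a corner between \<open>m - 1\<close> and \<open>m\<close>; there the edges
  of colors \<open>m - 1\<close> and \<open>m\<close> coincide by axiom 4.
\<close>

lemma between_edge:
  assumes inv: "labelling (Suc (Suc k))" and e: "E (Suc (Suc k)) w x"
    and w: "label (Suc (Suc (Suc k))) w = q # p # a # t" and q: "min a p < q" "q < max a p"
  shows "label (Suc (Suc (Suc k))) x = q # a # p # t \<and> x \<in> comp (Suc (Suc k)) w"
proof -
  let ?m = "Suc (Suc k)" and ?M = "Suc (Suc (Suc k))"
  have mn: "?m < n" using E_range[OF e] by simp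
  have P: "partial_label ?M ?m" using partial_label_Suc[OF inv mn] .
  have wV: "w \<in> V" using E_verts[OF e] by simp
  have val: "valid (q # p # a # t)" using partial_labelD(1)[OF P wV] w by simp
  have len: "length t = k" using length_label[of ?M w] w by simp
  have v2: "valid (p # a # t)" and nonadj: "p \<noteq> a + 1" "p \<noteq> a - 1" using val q by auto
  have vt: "valid t" using v2 by simp
  note ad = valid_Cons_Cons_addable[OF v2 nonadj]
  obtain s where s: "min a p < s" "s < max a p" "removable (shape t) s"
    using removable_between[OF ad] removable_between[OF ad(2,1)] q by (cases "a < p") auto
  obtain t2 where t2: "valid (s # t2)" "shape (s # t2) = shape t" "length t = Suc (length t2)"
    using removable_last[OF vt s(3)] by blast
  have len2: "k = Suc (length t2)" using t2(3) len by simp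
  obtain w' where w': "w' \<in> comp k w" "label ?M w' = [q, p, a] @ (s # t2)"
    using reach[OF P _ wV, of k "[q, p, a]" t "s # t2"] w len t2 by auto
  have w'V: "w' \<in> V" using comp_V[OF w'(1)] by simp
  have S: "S w' k \<longleftrightarrow> s < a" "S w' (Suc k) \<longleftrightarrow> a < p" "S w' (Suc (Suc k)) \<longleftrightarrow> p < q"
    using partial_labelD(2)[OF P w'V, of k] partial_labelD(2)[OF P w'V, of "Suc k"] partial_labelD(2)[OF P w'V, of ?m]
      w'(2) len2 by auto
  obtain y' where y': "E (Suc k) w' y'" using E_ex[OF w'V, of "Suc k"] S s q mn len2 by auto
  obtain x' where x': "E ?m w' x'" using E_ex[OF w'V, of ?m] S s q mn by auto
  have ly: "label ?M y' = [q, a, p] @ (s # t2)"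
    using partial_labelD(3)[OF P y'] w'(2) len2 s q by auto
  have y'V: "y' \<in> V" using E_verts[OF y'] by simp
  have "S y' (Suc k) \<longleftrightarrow> p < a" "S y' ?m \<longleftrightarrow> a < q"
    using partial_labelD(2)[OF P y'V, of "Suc k"] partial_labelD(2)[OF P y'V, of ?m] ly len2 by auto
  then obtain z where z: "E ?m y' z" using E_ex[OF y'V, of ?m] q mn by auto
  \<comment> \<open>Otherwise \<open>y'\<close> would be an end of a path without an edge of color
    \<open>?m\<close>, but the signs at \<open>y'\<close> demand one.\<close>
  have "x' = y'" using two_color(2)[of ?m w' x' y' z] x' y' z len2 by auto
  then have e': "E ?m w' y'" using x' by simp
  obtain w'' y'' where wy: "E ?m w'' y''" "w'' \<in> comp k w'" "y'' \<in> comp k y'"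
    "label ?M w'' = [q, p, a] @ t" "label ?M y'' = [q, a, p] @ t"
    by (rule transport[OF P _ e' _ w'(2) ly _ vt len]) (use t2 len in auto)
  \<comment> \<open>The small letters are back in their old places, so \<open>w''\<close> and
    \<open>w\<close> have the same label and lie in the same component.\<close>
  have "w'' \<in> comp ?m w" using comp_mono[OF comp_trans[OF w'(1) wy(2)]] by simp
  moreover have "label ?m w = label ?m w''" using label_tl[of ?m] w wy(4) by simp
  ultimately have "w = w''" using labellingD(2)[OF inv] by blast
  then have "y'' = x" using E_unique[OF wy(1)] e by blast
  moreover have "y'' \<in> comp ?m w"
    using comp_trans[OF comp_mono[OF w'(1)] comp_trans[OF comp_E[OF y'] comp_mono[OF wy(3)]]] by simp
  ultimately show ?thesis using wy(5) by simp
qed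

text \<open>Here the letter \<open>k + 1\<close>, at \<open>a\<close>, has the middle content and
  should stay. The letters up to \<open>k\<close> are kept by axiom 5, so it suffices that the edges
  parallel to the given one preserve the signs of index \<open>k\<close> that place
  \<open>k + 1\<close>.\<close>

lemma swap_edge_tail:
  assumes inv: "labelling k" "labelling (Suc (Suc k))" and e: "E (Suc (Suc k)) w x"
    and w: "label (Suc (Suc (Suc k))) w = q # p # a # t" and "p < a" "a < q"
    and inv1: "labelling (Suc k)"
  shows "\<exists>q' p'. label (Suc (Suc (Suc k))) x = q' # p' # a # t"
proof -
  let ?m = "Suc (Suc k)" and ?M = "Suc (Suc (Suc k))"
  have mn: "?m < n" using E_range[OF e] by simp
  have P: "partial_label ?M ?m" using partial_label_Suc[OF inv(2) mn] .
  have V: "w \<in> V" "x \<in> V" using E_verts[OF e] by simp_all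
  have lw: "label k w = t" "label (Suc k) w = a # t" using w label_tl[of k w] label_tl[of "Suc k" w] label_tl[of ?m w] by simp_all
  have l: "label k x = t" using labellingD(3)[OF inv(1) e] lw(1) by simp
  have kn: "k < n" using mn by simp
  have g: "next_content k (label k) w a" using next_content_label[OF inv(1) kn V(1)] lw by simp
  have "next_content k (label k) x a"
    unfolding next_content_def
  proof (intro conjI impI ballI)
    show "addable (shape (label k x)) a" using g l lw unfolding next_content_def by auto
    fix u' assume k: "0 < k" and "u' \<in> comp k x"
    then obtain cs where cs: "walk G x cs u'" "set cs \<subseteq> {2..<k}" unfolding comp_def by auto
    then obtain u where u: "E ?m u' u" "walk G w cs u"
      using walk_E_commute[OF cs(1) _ cs(2), of ?m w] e E_sym by auto
    then have uc: "u \<in> comp k w" using cs(2) unfolding comp_def by blast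
    then have "S u k \<longleftrightarrow> hd (label k u) < a" using g k unfolding next_content_def by blast
    moreover have "label k u = label k u'" using labellingD(3)[OF inv(1) u(1)] by auto
    moreover have "S u' k = S u k"
    proof (rule ccontr)
      \<comment> \<open>By axioms 1 and 3 both ends then have an edge of color \<open>k + 1\<close>,
        which by axiom 4 is parallel to the edge of color \<open>?m\<close>. So its effect is known:
        it keeps \<open>q\<close> and puts the letter below it at \<open>p\<close> or
        \<open>a\<close>. Both are less than \<open>q\<close>, so the sign of index
        \<open>?m\<close> would not flip.\<close>
      assume d: "S u' k \<noteq> S u k"
      have e2: "E ?m u u'" using u(1) E_sym by simp
      have uV: "u \<in> V" "u' \<in> V" using E_verts[OF e2] by simp_all
      have "S u k \<noteq> S u (Suc k)" "S u' k \<noteq> S u' (Suc k)"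
        using E_near_below[OF e2] E_near_below[OF u(1)] d k by auto
      then obtain y z where y: "E (Suc k) u y" and z: "E (Suc k) u' z"
        using E_ex[OF uV(1), of "Suc k"] E_ex[OF uV(2), of "Suc k"] k mn by auto
      then have "u' = y" using two_color(1)[of ?m u u' y z] e2 k by auto
      obtain b t2 where lu: "label ?M u = q # p # a # b # t2"
        using partial_label_app[OF P uc, of "[q, p, a]" t] w k lw length_label[of k w]
        by (auto simp: length_Suc_conv gr0_conv_Suc)
      have lt2: "k = Suc (length t2)" using length_label[of ?M u] lu by simp
      have "S u ?m" using partial_labelD(2)[OF P uV(1), of ?m] lu lt2 assms(5,6) by auto
      moreover have "label ?M u' = q # top3 (p # a # b # t2)"
        using partial_labelD(3)[OF P y] \<open>u' = y\<close> lu lt2 by auto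
      then have "S u' ?m" using partial_labelD(2)[OF P uV(2), of ?m] lt2 assms(5,6) by auto
      ultimately show False using E_flip(1)[OF e2] by simp
    qed
    ultimately show "S u' k \<longleftrightarrow> hd (label k u') < a" by simp
  qed
  then have "hd (label (Suc k) x) = a" using next_content_unique[OF inv(1) V(2) next_content_label[OF inv(1) kn V(2)]] by simp
  then have "label (Suc k) x = a # t" using l label_Suc_eq by metis
  then show ?thesis using label_Suc_eq by metis
qed

text \<open>
  The place \<open>q\<close> of the letter \<open>m\<close> at \<open>x\<close> is read off from \<open>\<sigma>\<^bsub>m-1\<^esub>\<close> as the letter \<open>m - 1\<close> runs
  through the corners \<open>r\<close>. For \<open>r\<close> between \<open>a\<close> and \<open>q\<close> the three-color component is the
  six-vertex graph, for \<open>r\<close> beyond \<open>q\<close> it is the five-vertex graph.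
\<close>

lemma swap_edge_second:
  assumes inv: "labelling k" "labelling (Suc k)" "labelling (Suc (Suc k))" and e: "E (Suc (Suc k)) w x"
    and w: "label (Suc (Suc (Suc k))) w = q # p # a # t" and pa: "p < a" "a < q"
  shows "\<exists>q'. label (Suc (Suc (Suc k))) x = q' # q # a # t \<and> q' < a"
proof -
  let ?m = "Suc (Suc k)" and ?M = "Suc (Suc (Suc k))"
  have mn: "?m < n" using E_range[OF e] by simp
  have P: "partial_label ?M ?m" using partial_label_Suc[OF inv(3) mn] .
  have V: "w \<in> V" "x \<in> V" using E_verts[OF e] by simp_all
  obtain q' p' where x: "label ?M x = q' # p' # a # t"
    using swap_edge_tail[OF inv(1,3) e w pa inv(2)] by blast
  have len: "length t = k" using length_label[of ?M w] w by simp
  have vw: "valid (q # p # a # t)" using partial_labelD(1)[OF P V(1)] w by simp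
  have vx: "valid (q' # p' # a # t)" using partial_labelD(1)[OF P V(2)] x by simp
  have lx: "label (Suc k) x = a # t" using x label_tl[of "Suc k" x] label_tl[of ?m x] by simp
  have hx: "hd (label ?m x) = p'" using x label_tl[of ?m x] by simp
  have kn: "Suc k < n" using mn by simp
  have g: "next_content (Suc k) (label (Suc k)) x p'" using next_content_label[OF inv(2) kn V(2)] hx by simp
  have Sw: "\<not> S w (Suc k)" "S w ?m"
    using partial_labelD(2)[OF P V(1), of "Suc k"] partial_labelD(2)[OF P V(1), of ?m] w len pa by auto
  have Sx: "S x (Suc k)" "\<not> S x ?m" using E_flip(1,2)[OF e] Sw by auto
  then have ap': "a < p'" using partial_labelD(2)[OF P V(2), of "Suc k"] x len kn by auto
  have adq: "addable (shape (a # t)) q" using vw pa by (auto simp: addable_def shape_Cons)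
  have "next_content (Suc k) (label (Suc k)) x q"
    unfolding next_content_def
  proof (intro conjI impI ballI)
    show "addable (shape (label (Suc k) x)) q" using adq lx by simp
    fix u assume u: "u \<in> comp (Suc k) x"
    define r where "r = hd (label (Suc k) u)"
    have "shape (label (Suc k) u) = shape (a # t)"
      using partial_label_shape[OF labellingD(1)[OF inv(2)] u] lx by simp
    then have rem: "removable (shape (a # t)) r"
      using removable_shape_Cons r_def label_Suc_eq by metis
    have "r < p' \<longleftrightarrow> r < q"
    proof (cases "a < r")
      case False
      then show ?thesis using ap' pa by auto
    next
      case True
      \<comment> \<open>With \<open>k\<close> at \<open>r\<close> and \<open>k - 1\<close> at
        \<open>s\<close>, the edge of color \<open>k\<close> exchanges \<open>a\<close> and
        \<open>r\<close>. It leads to vertices \<open>w2\<close> and \<open>x2\<close> with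
        \<open>k + 1\<close> at \<open>r\<close>, where the sign of index \<open>k + 1\<close> at
        \<open>x2\<close> compares \<open>r\<close> with \<open>p'\<close>.\<close>
      obtain s t2 where s: "min a r < s" "s < max a r"
        "valid (a # r # s # t2)" "valid (r # a # s # t2)"
        "shape (r # s # t2) = shape t" "length t = length t2 + 2"
        by (rule two_corners[OF _ rem]) (use True vw in auto)
      have len2: "k = Suc (Suc (length t2))" using s(6) len by simp
      have w3: "label ?M w = [q, p, a] @ t" and x3: "label ?M x = [q', p', a] @ t" using w x by simp_all
      obtain w1 x1 where wx1: "E ?m w1 x1" "w1 \<in> comp k w" "x1 \<in> comp k x"
        "label ?M w1 = [q, p, a] @ r # s # t2" "label ?M x1 = [q', p', a] @ r # s # t2"
        by (rule transport[OF P _ e _ w3 x3 len, of "r # s # t2"]) (use s len in auto)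
      have V1: "w1 \<in> V" "x1 \<in> V" using E_verts[OF wx1(1)] by simp_all
      have S1: "S w1 (k - 1)" "\<not> S w1 k" "S x1 (k - 1)" "\<not> S x1 k"
        using partial_labelD(2)[OF P V1(1), of "k - 1"] partial_labelD(2)[OF P V1(1), of k]
          partial_labelD(2)[OF P V1(2), of "k - 1"] partial_labelD(2)[OF P V1(2), of k] wx1(4,5) len2 True s(1,2) by auto
      then obtain w2 x2 where w2: "E k w1 w2" and x2: "E k x1 x2"
        using E_ex[OF V1(1), of k] E_ex[OF V1(2), of k] len2 mn by auto
      have V2: "w2 \<in> V" "x2 \<in> V" using E_verts[OF w2] E_verts[OF x2] by simp_all
      have l2: "label ?M w2 = q # p # r # a # s # t2" "label ?M x2 = q' # p' # r # a # s # t2"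
        using partial_labelD(3)[OF P w2] partial_labelD(3)[OF P x2] wx1(4,5) len2 True s(1,2) by auto
      have S2: "S w2 k" "\<not> S w2 (Suc k)" "S w2 ?m"
        using partial_labelD(2)[OF P V2(1), of k] partial_labelD(2)[OF P V2(1), of "Suc k"] partial_labelD(2)[OF P V2(1), of ?m]
          l2 len2 True pa by auto
      have S2': "S x2 (Suc k) \<longleftrightarrow> r < p'"
        using partial_labelD(2)[OF P V2(2), of "Suc k"] l2 len2 by auto
      obtain y where y: "E ?m w2 y" using E_ex[OF V2(1), of ?m] S2 mn by auto
      obtain z where z: "E (Suc k) w2 z" using E_ex[OF V2(1), of "Suc k"] S2 mn len2 by auto
      have zV: "z \<in> V" using E_verts[OF z] by simp
      have lz: "label ?M z = q # r # p # a # s # t2"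
        using partial_labelD(3)[OF P z] l2 len2 True pa by auto
      have Sz: "S z (Suc k)" "S z ?m \<longleftrightarrow> r < q"
        using partial_labelD(2)[OF P zV, of "Suc k"] partial_labelD(2)[OF P zV, of ?m] lz len2 True pa by auto
      have m4: "4 \<le> ?m" "3 \<le> ?m" and m12: "?m - 2 = k" "?m - 1 = Suc k" using len2 by auto
      show ?thesis
      proof (cases "r < q")
        case rq: True
        \<comment> \<open>The sign of index \<open>?m\<close> is positive at both \<open>w2\<close>
          and \<open>z\<close>, so no edge of that color joins them.\<close>
        have "z \<noteq> y" using E_flip(1)[OF y] S2 Sz rq by auto
        moreover have "z \<noteq> w1" using lz wx1(4) pa True by auto
        ultimately obtain v where "E ?m w1 v" "E k y v"
          using three_color_square[OF m4(1), unfolded m12, of w2 w1 y z] y z w2 E_sym by blast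
        then have "E k x1 y" using E_unique[OF wx1(1)] E_sym by blast
        then have "y = x2" using E_unique x2 by blast
        then have "S x2 (Suc k)" using E_flip(2)[OF y] S2 by simp
        then show ?thesis using rq S2' by simp
      next
        case rq: False
        then obtain z' where "E ?m z z'" using E_ex[OF zV, of ?m] Sz mn by auto
        \<comment> \<open>Now \<open>z\<close> has an edge of color \<open>?m\<close>, so it cannot
          be the end of a two-color path and the edges at \<open>w2\<close> are parallel.\<close>
        then have "y = z" using two_color(2)[OF m4(2), unfolded m12, of w2 y z] y z by blast
        then obtain b where "E k x1 b" "E (Suc k) x1 b"
          using three_color_double_up[OF m4(1), unfolded m12, of w1 w2 z x1] w2 y z wx1(1) by blast
        then have f: "E (Suc k) x1 x2" using E_unique x2 by blast
        have "S x1 (Suc k)"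
          using partial_labelD(2)[OF P V1(2), of "Suc k"] wx1(5) len2 ap' by auto
        then show ?thesis using E_flip(1)[OF f] S2' rq by simp
      qed
    qed
    then show "S u (Suc k) \<longleftrightarrow> hd (label (Suc k) u) < q"
      using g u unfolding next_content_def r_def by simp
  qed
  then have pq: "p' = q" using next_content_unique[OF inv(2) V(2) g] by simp
  have "q' < q" using Sx(2) partial_labelD(2)[OF P V(2), of ?m] x len pq valid3_neq[OF vx] by auto
  \<comment> \<open>If \<open>q'\<close> were in the middle, \<open>between_edge\<close> would
    describe the edge from the side of \<open>x\<close> and give \<open>w\<close> a wrong
    label.\<close>
  moreover have "\<not> (a < q' \<and> q' < q)"
  proof
    assume "a < q' \<and> q' < q"
    then have "label ?M w = q' # a # q # t"
      using between_edge[OF inv(3), of x w q' q a t] e E_sym x pq by auto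
    then show False using w pa by simp
  qed
  ultimately have "q' < a" using valid3_neq[OF vx] by auto
  then show ?thesis using x pq by simp
qed

text \<open>The place \<open>q'\<close> of the letter \<open>?M\<close> at \<open>x\<close> is read
  off from the sign of index \<open>?m\<close> as \<open>?m\<close> runs through the corners
  \<open>r\<close>. Only \<open>r < a\<close> is in question, since \<open>p\<close> and
  \<open>q'\<close> are both below \<open>a\<close>: for \<open>p < r\<close> the three-color
  component has six vertices, for \<open>r < p\<close> it has five.\<close>

lemma swap_edge:
  assumes inv: "labelling k" "labelling (Suc k)" "labelling (Suc (Suc k))" and e: "E (Suc (Suc k)) w x"
    and w: "label (Suc (Suc (Suc k))) w = q # p # a # t" and pa: "p < a" "a < q"
  shows "label (Suc (Suc (Suc k))) x = p # q # a # t"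
proof -
  let ?m = "Suc (Suc k)" and ?M = "Suc (Suc (Suc k))"
  have mn: "?m < n" using E_range[OF e] by simp
  have P: "partial_label ?M ?m" using partial_label_Suc[OF inv(3) mn] .
  have V: "w \<in> V" "x \<in> V" using E_verts[OF e] by simp_all
  obtain q' where x: "label ?M x = q' # q # a # t" and q': "q' < a"
    using swap_edge_second[OF inv e w pa] by blast
  have len: "length t = k" using length_label[of ?M w] w by simp
  have vw: "valid (q # p # a # t)" using partial_labelD(1)[OF P V(1)] w by simp
  have lx: "label ?m x = q # a # t" using x label_tl[of ?m x] by simp
  have hx: "hd (label ?M x) = q'" using x by simp
  have g: "next_content ?m (label ?m) x q'" using next_content_label[OF inv(3) mn V(2)] hx by simp
  have adp: "addable (shape (q # a # t)) p" using vw pa by (auto simp: addable_def shape_Cons)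
  have "next_content ?m (label ?m) x p"
    unfolding next_content_def
  proof (intro conjI impI ballI)
    show "addable (shape (label ?m x)) p" using adp lx by simp
    fix u assume u: "u \<in> comp ?m x"
    define r where "r = hd (label ?m u)"
    have "shape (label ?m u) = shape (q # a # t)"
      using partial_label_shape[OF labellingD(1)[OF inv(3)] u] lx by simp
    then have rem': "removable (shape (q # a # t)) r"
      using removable_shape_Cons r_def label_Suc_eq by metis
    have rp: "r \<noteq> p" using adp rem' unfolding addable_def removable_def by auto
    have "r < q' \<longleftrightarrow> r < p"
    proof (cases "r < a")
      case False
      then show ?thesis using q' pa by auto
    next
      case True
      then have rem: "removable (shape (a # t)) r"
        using rem' pa by (auto simp: removable_def shape_Cons)
      obtain s t2 where s: "min a r < s" "s < max a r"
        "valid (a # r # s # t2)" "valid (r # a # s # t2)"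
        "shape (r # s # t2) = shape t" "length t = length t2 + 2"
        by (rule two_corners[OF _ rem]) (use True vw in auto)
      have len2: "k = Suc (Suc (length t2))" using s(6) len by simp
      have w3: "label ?M w = [q, p, a] @ t" and x3: "label ?M x = [q', q, a] @ t" using w x by simp_all
      obtain w1 x1 where wx1: "E ?m w1 x1" "w1 \<in> comp k w" "x1 \<in> comp k x"
        "label ?M w1 = [q, p, a] @ r # s # t2" "label ?M x1 = [q', q, a] @ r # s # t2"
        by (rule transport[OF P _ e _ w3 x3 len, of "r # s # t2"]) (use s len in auto)
      have V1: "w1 \<in> V" "x1 \<in> V" using E_verts[OF wx1(1)] by simp_all
      have S1: "\<not> S w1 (k - 1)" "S w1 k" "\<not> S x1 (k - 1)" "S x1 k" "\<not> S w1 (Suc k)"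
        using partial_labelD(2)[OF P V1(1), of "k - 1"] partial_labelD(2)[OF P V1(1), of k]
          partial_labelD(2)[OF P V1(1), of "Suc k"]
          partial_labelD(2)[OF P V1(2), of "k - 1"] partial_labelD(2)[OF P V1(2), of k] wx1(4,5) len2 True s(1,2) pa by auto
      then obtain w2 x2 where w2: "E k w1 w2" and x2: "E k x1 x2"
        using E_ex[OF V1(1), of k] E_ex[OF V1(2), of k] len2 mn by auto
      have V2: "w2 \<in> V" "x2 \<in> V" using E_verts[OF w2] E_verts[OF x2] by simp_all
      have l2: "label ?M w2 = q # p # r # a # s # t2" "label ?M x2 = q' # q # r # a # s # t2"
        using partial_labelD(3)[OF P w2] partial_labelD(3)[OF P x2] wx1(4,5) len2 True s(1,2) by auto
      obtain z where z: "E (Suc k) w1 z" using E_ex[OF V1(1), of "Suc k"] S1 mn len2 by auto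
      have zV: "z \<in> V" using E_verts[OF z] by simp
      have m4: "4 \<le> ?m" "3 \<le> ?m" and m12: "?m - 2 = k" "?m - 1 = Suc k" using len2 by auto
      show ?thesis
      proof (cases "p < r")
        case pr: True
        have lz: "label ?M z = q # a # p # r # s # t2"
          using partial_labelD(3)[OF P z] wx1(4) len2 True pr by auto
        then have "S z ?m" using partial_labelD(2)[OF P zV, of ?m] len2 pa by auto
        moreover have "S w1 ?m" using partial_labelD(2)[OF P V1(1), of ?m] wx1(4) len2 pa by auto
        ultimately have "z \<noteq> x1" using E_flip(1)[OF wx1(1)] by auto
        moreover have "z \<noteq> w2" using lz l2 pa by auto
        ultimately obtain v where v: "E ?m w2 v" "E k x1 v"
          using three_color_square[OF m4(1), unfolded m12, of w1 w2 x1 z] wx1(1) z w2 by blast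
        then have "E ?m w2 x2" using E_unique x2 by blast
        \<comment> \<open>The parallel edge from \<open>w2\<close> to \<open>x2\<close> is again of
          the kind treated in \<open>swap_edge_second\<close>, now with \<open>r\<close> in the role
          of \<open>a\<close>.\<close>
        then have "q' < r" using swap_edge_second[OF inv, of w2 x2 q p r] l2 pr True pa by auto
        then show ?thesis using pr by simp
      next
        case pr: False
        then have pr: "r < p" using rp by simp
        have "label ?M z = q # p # r # a # s # t2"
          using partial_labelD(3)[OF P z] wx1(4) len2 True pr pa by auto
        then have "label ?m z = label ?m w2" using l2(1) label_tl[of ?m] by simp
        moreover have "w2 \<in> comp ?m z"
          using comp_trans[OF comp_sym[OF comp_E[OF z]] comp_E[OF w2]] by simp
        \<comment> \<open>The edges of colors \<open>k\<close> and \<open>k + 1\<close> at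
          \<open>w1\<close> coincide, since both act by exchanging the contents \<open>a\<close> and
          \<open>r\<close>.\<close>
        ultimately have "z = w2" using labellingD(2)[OF inv(3)] by blast
        then obtain d d' where d: "E k x1 d" "E (Suc k) d d'" "E ?m d d'"
          using three_color_double_down[OF m4(1), unfolded m12, of w1 w2 x1] w2 z wx1(1) by blast
        then have f: "E (Suc k) x2 d'" "E ?m x2 d'" using E_unique x2 by blast+
        have dV: "d' \<in> V" using E_verts[OF f(1)] by simp
        have "label ?M d' = q' # r # q # a # s # t2"
          using partial_labelD(3)[OF P f(1)] l2 len2 True pa by auto
        then have "S d' ?m \<longleftrightarrow> r < q'" using partial_labelD(2)[OF P dV, of ?m] len2 by auto
        moreover have "\<not> S x2 ?m" using partial_labelD(2)[OF P V2(2), of ?m] l2 len2 q' pa by auto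
        ultimately show ?thesis using E_flip(1)[OF f(2)] pr by simp
      qed
    qed
    then show "S u ?m \<longleftrightarrow> hd (label ?m u) < p"
      using g u unfolding next_content_def r_def by simp
  qed
  then have "q' = p" using next_content_unique[OF inv(3) V(2) g] by simp
  then show ?thesis using x by simp
qed

text \<open>The ends may be exchanged because \<open>top3\<close> is an involution, so let the sign
  of index \<open>k + 1\<close> be negative at \<open>w\<close>. Then \<open>p\<close> is the least
  of the three contents, and the order of \<open>q\<close> and \<open>a\<close> selects the lemma to
  use.\<close>

lemma edge_top3:
  assumes inv: "labelling k" "labelling (Suc k)" "labelling (Suc (Suc k))" and e: "E (Suc (Suc k)) w x"
  shows "label (Suc (Suc (Suc k))) x = top3 (label (Suc (Suc (Suc k))) w)"
proof -
  let ?m = "Suc (Suc k)" and ?M = "Suc (Suc (Suc k))"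
  have mn: "?m < n" using E_range[OF e] by simp
  have P: "partial_label ?M ?m" using partial_label_Suc[OF inv(3) mn] .
  have *: "label ?M x = top3 (label ?M w)" if e: "E ?m w x" and S: "\<not> S w (Suc k)" for w x
  proof -
    have V: "w \<in> V" using E_verts[OF e] by simp
    obtain q p a t where w: "label ?M w = q # p # a # t" and len: "length t = k"
      by (metis label_Suc_eq length_label)
    have ne: "a \<noteq> p" "p \<noteq> q" "a \<noteq> q" using partial_labelD(1)[OF P V] w valid3_neq by metis+
    have "S w ?m" using E_flip(3)[OF e] S by simp
    then have "p < a" "p < q" using S partial_labelD(2)[OF P V, of "Suc k"] partial_labelD(2)[OF P V, of ?m] w len ne by auto
    then show ?thesis
      using between_edge[OF inv(3) e w] swap_edge[OF inv e w] w ne by (cases "q < a") auto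
  qed
  show ?thesis
  proof (cases "S w (Suc k)")
    case True
    have e': "E ?m x w" using e E_sym by simp
    have "\<not> S x (Suc k)" using E_flip(2)[OF e] True by simp
    then have "label ?M w = top3 (label ?M x)" using *[OF e'] by simp
    then show ?thesis using top3_top3[OF partial_labelD(1)[OF P]] E_verts[OF e] by simp
  qed (use * e in blast)
qed

section \<open>Distinct labels within a component, and the induction\<close>

lemma inj_Suc:
  assumes inv: "labelling k" "labelling (Suc k)" "labelling (Suc (Suc k))" and mn: "Suc (Suc k) < n"
    and x: "x \<in> comp (Suc (Suc (Suc k))) v"
    and l: "label (Suc (Suc (Suc k))) v = label (Suc (Suc (Suc k))) x"
  shows "v = x"
proof -
  let ?m = "Suc (Suc k)" and ?M = "Suc (Suc (Suc k))"
  have P: "partial_label ?M ?m" using partial_label_Suc[OF inv(3) mn] .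
  have V: "v \<in> V" "x \<in> V" using comp_V[OF x] by simp_all
  have "comp ?M v = {w. \<exists>cs. set cs \<subseteq> {2..?m} \<and> walk G v cs w}"
    unfolding comp_def by (simp add: atLeastLessThanSuc_atLeastAtMost)
  then have "comp ?M v \<in> components G {2..?m}" using V(1) unfolding components_def by blast
  moreover have "?m \<in> {2..<n}" using mn by simp
  ultimately obtain cs where cs: "set cs \<subseteq> {2..?m}" "walk G v cs x" "count_list cs ?m \<le> 1"
    using deg x comp_refl[OF V(1)] unfolding dual_equivalence_graph_def ax6_def by blast
  have "x \<in> comp ?m v"
  proof (cases "?m \<in> set cs")
    case False
    then have "set cs \<subseteq> {2..<?m}" using set_below_top[OF cs(1)] by simp
    then show ?thesis using cs(2) unfolding comp_def by blast
  next
    case True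
    then obtain cs1 cs2 where c: "cs = cs1 @ ?m # cs2" by (metis split_list)
    then have "count_list cs1 ?m = 0" "count_list cs2 ?m = 0" using cs(3) by auto
    then have "?m \<notin> set cs1" "?m \<notin> set cs2" unfolding count_list_0_iff .
    moreover have "set cs1 \<subseteq> {2..?m}" "set cs2 \<subseteq> {2..?m}" using cs(1) c by simp_all
    ultimately have "set cs1 \<subseteq> {2..<?m}" "set cs2 \<subseteq> {2..<?m}"
      using set_below_top by blast+
    moreover obtain w where w: "walk G v cs1 w" "walk G w (?m # cs2) x"
      using walk_split[of G v cs1 "?m # cs2" x] cs(2) unfolding c by blast
    moreover obtain y where y: "E ?m w y" "walk G y cs2 x" using walk_Cons_E[OF w(2)] mn by auto
    ultimately have wv: "w \<in> comp ?m v" and xy: "x \<in> comp ?m y" unfolding comp_def by blast+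
    \<comment> \<open>The stretches before and after the edge of color \<open>?m\<close> leave the
      letter \<open>?M\<close> in place, so the edge does so too.\<close>
    have h: "hd (label ?M w) = hd (label ?M y)"
      using label_last_comp[OF inv(3) mn wv] label_last_comp[OF inv(3) mn xy] l by simp
    obtain q p a t where lw: "label ?M w = q # p # a # t" and len: "length t = k"
      by (metis label_Suc_eq length_label)
    have wV: "w \<in> V" using E_verts[OF y(1)] by simp
    have ne: "a \<noteq> p" "p \<noteq> q" "a \<noteq> q" using partial_labelD(1)[OF P wV] lw valid3_neq by metis+
    have "S w (Suc k) \<longleftrightarrow> a < p" "S w ?m \<longleftrightarrow> p < q"
      using partial_labelD(2)[OF P wV, of "Suc k"] partial_labelD(2)[OF P wV, of ?m] lw len by auto
    moreover have "S w (Suc k) \<longleftrightarrow> \<not> S w ?m" using E_flip(3)[OF y(1)] by simp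
    moreover have "hd (top3 (q # p # a # t)) = q" using edge_top3[OF inv y(1)] h lw by simp
    \<comment> \<open>Of the two moves possible here, only the one with \<open>?M\<close> in the
      middle keeps the head.\<close>
    ultimately have "min a p < q" "q < max a p" using ne by (auto split: if_splits)
    then have "y \<in> comp ?m w" using between_edge[OF inv(3) y(1) lw] by simp
    then show ?thesis using comp_trans[OF comp_trans[OF wv] xy] by blast
  qed
  moreover have "label ?m v = label ?m x" using l label_tl[of ?m] by simp
  ultimately show ?thesis using labellingD(2)[OF inv(3)] by blast
qed

text \<open>Strong induction, since the action of the color \<open>m\<close> is derived from the
  labellings at \<open>m - 2\<close>, \<open>m - 1\<close> and \<open>m\<close>. For
  \<open>m < 2\<close> there are no edges of color \<open>m\<close>.\<close>

lemma labelling_all: "m \<le> n \<Longrightarrow> labelling m"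
proof (induction m rule: less_induct)
  case (less M)
  show ?case
  proof (cases M)
    case 0
    then show ?thesis unfolding labelling_def partial_label_def by (auto simp: comp_def)
  next
    case (Suc m)
    then have inv: "labelling m" and mn: "m < n" using less by auto
    have P: "partial_label M m" using partial_label_Suc[OF inv mn] Suc by simp
    have k: "\<exists>k. m = Suc (Suc k) \<and> labelling k \<and> labelling (Suc k) \<and> labelling (Suc (Suc k))" if "2 \<le> m"
      using that less Suc by (intro exI[of _ "m - 2"]) auto
    have "label M x = dual_equiv i (label M v)" if e: "E i v x" and "i < M" for i v x
    proof (cases "i = m")
      case True
      then obtain k where "m = Suc (Suc k)" "labelling k" "labelling (Suc k)" "labelling (Suc (Suc k))"
        using k E_range[OF e] by auto
      then have "label M x = top3 (label M v)" using edge_top3[of k v x] e True Suc by simp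
      then show ?thesis using label_Suc_eq[of m v] True Suc by (metis dual_equiv.simps(2) length_label)
    qed (use partial_labelD(3)[OF P e] that Suc in auto)
    then have "partial_label M M" using P Suc mn unfolding partial_label_def by auto
    moreover have "v = x" if x: "x \<in> comp M v" and l: "label M v = label M x" for v x
    proof (cases "2 \<le> m")
      case True
      then show ?thesis using k inj_Suc[of _ x v] mn x l Suc by blast
    next
      case False
      then have "{2..<M} = {}" using Suc by auto
      then show ?thesis using x unfolding comp_def by auto
    qed
    moreover have "label M x = label M v" if "E i v x" "M + 2 \<le> i" for i v x
      using label_far_Suc[OF inv that(1)] that(2) Suc by auto
    ultimately show ?thesis unfolding labelling_def by blast
  qed
qed

end

section \<open>From content sequences to tableaux\<close>

text \<open>The \<open>d\<close>-th cell, counted from the southwest, of the diagonal of content \<open>x\<close>.\<close>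

definition cell :: "int \<Rightarrow> nat \<Rightarrow> nat \<times> nat" where
  "cell x d = (if 0 \<le> x then (nat x + d, d) else (d, nat (- x) + d))"

text \<open>\<open>min i j\<close> is the position of a cell on its diagonal, so a content that
  occurs \<open>d\<close> times fills the \<open>d\<close> southwesternmost cells of its
  diagonal.\<close>

definition cells :: "int list \<Rightarrow> (nat \<times> nat) set" where
  "cells t = {(i, j). 1 \<le> i \<and> 1 \<le> j \<and> min i j \<le> count_list t (int i - int j)}"

abbreviation ncell :: "int \<Rightarrow> int list \<Rightarrow> nat \<times> nat" where
  "ncell c t \<equiv> cell c (Suc (count_list t c))"

text \<open>The value outside the cells is \<open>undefined\<close> to agree with
  \<open>extensional\<close> in \<open>SYT\<close>.\<close>

fun filling :: "int list \<Rightarrow> nat \<times> nat \<Rightarrow> nat" where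
  "filling [] = (\<lambda>_. undefined)"
| "filling (c # t) = (filling t)(ncell c t := Suc (length t))"

declare filling.simps(2) [simp del]

lemma filling_Cons: "filling (c # t) z = (if z = ncell c t then Suc (length t) else filling t z)"
  by (simp add: filling.simps(2))

lemma cell_eq_iff: "cell x d = (i, j) \<longleftrightarrow> x = int i - int j \<and> d = min i j"
  unfolding cell_def by auto

lemma content_cell [simp]: "content (cell x d) = x"
  unfolding cell_def content_def by auto

lemma cell_eq_cell [simp]: "cell x d = cell y e \<longleftrightarrow> x = y \<and> d = e"
  unfolding cell_def by auto

lemma cell_in_cells: "1 \<le> d \<Longrightarrow> cell x d \<in> cells t \<longleftrightarrow> d \<le> count_list t x"
  unfolding cell_def cells_def by auto

lemma cells_Nil [simp]: "cells [] = {}"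
  unfolding cells_def by auto

lemma ncell_notin: "ncell c t \<notin> cells t"
  using cell_in_cells[of "Suc (count_list t c)" c t] by simp

lemma cells_Cons: "cells (c # t) = insert (ncell c t) (cells t)"
proof (rule set_eqI, clarify)
  fix i j
  have e: "ncell c t = (i, j) \<longleftrightarrow> c = int i - int j \<and> Suc (count_list t c) = min i j"
    by (rule cell_eq_iff)
  show "(i, j) \<in> cells (c # t) \<longleftrightarrow> (i, j) \<in> insert (ncell c t) (cells t)"
  proof (cases "c = int i - int j")
    case True
    have 1: "(i, j) = ncell c t \<longleftrightarrow> min i j = Suc (count_list t c)"
      using e True by metis
    have 2: "(i, j) \<in> cells (c # t) \<longleftrightarrow> 1 \<le> i \<and> 1 \<le> j \<and> min i j \<le> Suc (count_list t c)"
      "(i, j) \<in> cells t \<longleftrightarrow> 1 \<le> i \<and> 1 \<le> j \<and> min i j \<le> count_list t c"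
      unfolding cells_def by (simp_all add: True)
    have "min i j = Suc (count_list t c) \<Longrightarrow> 1 \<le> i \<and> 1 \<le> j" by linarith
    then show ?thesis unfolding insert_iff 1 2 le_Suc_eq by blast
  next
    case False
    then have "(i, j) \<noteq> ncell c t" using e by metis
    moreover have "(i, j) \<in> cells (c # t) \<longleftrightarrow> (i, j) \<in> cells t"
      using False unfolding cells_def by simp
    ultimately show ?thesis by blast
  qed
qed

lemma finite_cells [simp]: "finite (cells t)"
  by (induction t) (auto simp: cells_Cons)

lemma card_cells: "card (cells t) = length t"
  by (induction t) (auto simp: cells_Cons ncell_notin)

lemma nat_eq_if_le_iff:
  fixes a b :: nat
  assumes "\<And>d. 1 \<le> d \<Longrightarrow> d \<le> a \<longleftrightarrow> d \<le> b"
  shows "a = b"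
  using assms[of a] assms[of b] by (cases a; cases b) auto

lemma cells_eq_iff: "cells t = cells t' \<longleftrightarrow> (\<forall>x. count_list t x = count_list t' x)"
proof
  assume e: "cells t = cells t'"
  show "\<forall>x. count_list t x = count_list t' x"
  proof
    fix x
    show "count_list t x = count_list t' x"
      by (rule nat_eq_if_le_iff) (simp only: cell_in_cells[symmetric] e)
  qed
qed (simp add: cells_def)

lemma shape_count:
  "valid t \<Longrightarrow> (of_bool (shape t x) :: int) =
     of_bool (0 < x) + int (count_list t x) - int (count_list t (x - 1))"
proof (induction t)
  case (Cons c t)
  then show ?case by (cases "x = c"; cases "x = c + 1") (auto simp: shape_Cons addable_def of_bool_def split: if_splits)
qed auto

text \<open>The path records only differences of the lengths of neighboring diagonals; the lengths
  are recovered by summing from a content \<open>L\<close> below which all diagonals are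
  empty.\<close>

lemma cells_eq_shape:
  assumes "valid t" "valid t'"
  shows "cells t = cells t' \<longleftrightarrow> shape t = shape t'"
proof
  assume "cells t = cells t'"
  then have c: "count_list t x = count_list t' x" for x using cells_eq_iff by auto
  show "shape t = shape t'"
  proof
    fix x
    have "(of_bool (shape t x) :: int) = of_bool (shape t' x)"
      using shape_count[OF assms(1), of x] shape_count[OF assms(2), of x] c by simp
    then show "shape t x = shape t' x" by (simp add: of_bool_def split: if_splits)
  qed
next
  assume s: "shape t = shape t'"
  have fin: "finite (set t \<union> set t')" by simp
  obtain L where L: "\<forall>x\<in>set t \<union> set t'. L < x"
  proof (cases "set t \<union> set t' = {}")
    case False
    have "Min (set t \<union> set t') - 1 < x" if "x \<in> set t \<union> set t'" for x
      using Min_le[OF fin that] by linarith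
    then show ?thesis using that by blast
  qed (use that in auto)
  have low: "count_list t x = count_list t' x" if "x \<le> L" for x
  proof -
    have "x \<notin> set t" "x \<notin> set t'" using L that by (meson UnI1 UnI2 leD)+
    then show ?thesis using count_notin by metis
  qed
  have "count_list t x = count_list t' x" for x
  proof (cases "x \<le> L")
    case False
    then have "L \<le> x" by simp
    then show ?thesis
    proof (induction rule: int_ge_induct)
      case (step x)
      then show ?case
        using shape_count[OF assms(1), of "x + 1"] shape_count[OF assms(2), of "x + 1"] s by simp
    qed (use low in simp)
  qed (use low in simp)
  then show "cells t = cells t'" using cells_eq_iff by simp
qed

definition down_closed :: "(nat \<times> nat) set \<Rightarrow> bool" where
  "down_closed D \<longleftrightarrow> (\<forall>i j. (i, j) \<in> D \<longrightarrow> 1 \<le> i \<and> 1 \<le> j \<and>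
     (1 < i \<longrightarrow> (i - 1, j) \<in> D) \<and> (1 < j \<longrightarrow> (i, j - 1) \<in> D))"

text \<open>By \<open>shape_count\<close> neighboring diagonals differ by at most one cell, and the
  longer one is the one nearer to the main diagonal.\<close>

lemma down_closed_cells:
  assumes "valid t"
  shows "down_closed (cells t)"
  unfolding down_closed_def
proof (intro allI impI)
  fix i j assume ij: "(i, j) \<in> cells t"
  then have p: "1 \<le> i" "1 \<le> j" "min i j \<le> count_list t (int i - int j)" unfolding cells_def by auto
  have s: "(of_bool (shape t x) :: int) \<le> 1 \<and> 0 \<le> (of_bool (shape t x) :: int)" for x by simp
  show "1 \<le> i \<and> 1 \<le> j \<and> (1 < i \<longrightarrow> (i - 1, j) \<in> cells t) \<and> (1 < j \<longrightarrow> (i, j - 1) \<in> cells t)"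
  proof (intro conjI impI)
    assume i: "1 < i"
    have e: "int (i - 1) - int j = int i - int j - 1" using i by simp
    have "min (i - 1) j \<le> count_list t (int i - int j - 1)"
      using shape_count[OF assms, of "int i - int j"] s[of "int i - int j"] p
      by (cases "j < i") (auto simp: min_def split: if_splits)
    then have "min (i - 1) j \<le> count_list t (int (i - 1) - int j)" by (simp only: e)
    then show "(i - 1, j) \<in> cells t" using i p unfolding cells_def by simp
  next
    assume j: "1 < j"
    have e: "int i - int (j - 1) = int i - int j + 1" using j by simp
    have "min i (j - 1) \<le> count_list t (int i - int j + 1)"
      using shape_count[OF assms, of "int i - int j + 1"] s[of "int i - int j + 1"] p
      by (cases "i < j") (auto simp: min_def split: if_splits)
    then have "min i (j - 1) \<le> count_list t (int i - int (j - 1))" by (simp only: e)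
    then show "(i, j - 1) \<in> cells t" using j p unfolding cells_def by simp
  qed (use p in auto)
qed

lemma down_closed_left:
  assumes "down_closed D" "(i', j) \<in> D" "1 \<le> i" "i \<le> i'"
  shows "(i, j) \<in> D"
  using assms(4,2,3)
proof (induction rule: inc_induct)
  case (step k)
  then show ?case using assms(1) unfolding down_closed_def by fastforce
qed

lemma down_closed_down:
  assumes "down_closed D" "(i, j') \<in> D" "1 \<le> j" "j \<le> j'"
  shows "(i, j) \<in> D"
  using assms(4,2,3)
proof (induction rule: inc_induct)
  case (step k)
  then show ?case using assms(1) unfolding down_closed_def by fastforce
qed

lemma filling_range: "z \<in> cells t \<Longrightarrow> 1 \<le> filling t z \<and> filling t z \<le> length t"
  by (induction t) (auto simp: cells_Cons filling_Cons)

lemma filling_outside: "z \<notin> cells t \<Longrightarrow> filling t z = undefined"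
  by (induction t) (auto simp: cells_Cons filling_Cons)

lemma content_filling: "z \<in> cells t \<Longrightarrow> content z = rev t ! (filling t z - 1)"
proof (induction t)
  case (Cons c t)
  show ?case
  proof (cases "z = ncell c t")
    case False
    then have "z \<in> cells t" using Cons.prems by (simp add: cells_Cons)
    then show ?thesis using Cons.IH False filling_range[of z t] by (auto simp: filling_Cons nth_append)
  qed (simp add: filling_Cons nth_append)
qed auto

lemma bij_filling: "bij_betw (filling t) (cells t) {1..length t}"
proof (induction t)
  case (Cons c t)
  have "bij_betw (filling (c # t)) (cells t) {1..length t}"
    using Cons by (rule bij_betw_cong[THEN iffD1, rotated]) (use ncell_notin in \<open>auto simp: filling_Cons\<close>)
  then have "bij_betw (filling (c # t)) (cells t \<union> {ncell c t}) ({1..length t} \<union> {Suc (length t)})"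
    by (rule bij_betw_combine) (auto simp: filling_Cons bij_betw_def)
  moreover have "{1..length t} \<union> {Suc (length t)} = {1..length (c # t)}" by auto
  ultimately show ?case by (simp add: cells_Cons)
qed (simp add: bij_betw_def)

text \<open>A cell left of or below an old cell is old, so the newest cell, which has the largest
  entry, can only be the greater of the two.\<close>

lemma filling_increasing:
  assumes "valid t"
  shows "(i, j) \<in> cells t \<Longrightarrow> (i', j) \<in> cells t \<Longrightarrow> i < i' \<Longrightarrow> filling t (i, j) < filling t (i', j)"
    and "(i, j) \<in> cells t \<Longrightarrow> (i, j') \<in> cells t \<Longrightarrow> j < j' \<Longrightarrow> filling t (i, j) < filling t (i, j')"
proof -
  have "((i, j) \<in> cells t \<longrightarrow> (i', j') \<in> cells t \<longrightarrow> i < i' \<and> j = j' \<or> i = i' \<and> j < j' \<longrightarrow>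
      filling t (i, j) < filling t (i', j'))" for i j i' j'
    using assms
  proof (induction t)
    case (Cons c t)
    have dc: "down_closed (cells t)" using Cons.prems down_closed_cells by simp
    show ?case
    proof (intro impI)
      assume a: "(i, j) \<in> cells (c # t)" "(i', j') \<in> cells (c # t)"
        "i < i' \<and> j = j' \<or> i = i' \<and> j < j'"
      have "1 \<le> i" "1 \<le> j" using a unfolding cells_def by auto
      then have "(i, j) \<in> cells t" if "(i', j') \<in> cells t"
        using a(3) down_closed_left[OF dc, of i' j i] down_closed_down[OF dc, of i j' j] that by auto
      moreover define z z' where "z = (i, j)" and "z' = (i', j')"
      ultimately have "z' \<in> cells t \<Longrightarrow> z \<in> cells t" "z \<noteq> z'" "z \<in> cells (c # t)" "z' \<in> cells (c # t)"
        using a by auto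
      moreover have "z \<in> cells t \<Longrightarrow> z' \<in> cells t \<Longrightarrow> filling t z < filling t z'"
        using Cons a(3) unfolding z_def z'_def by auto
      ultimately have "filling (c # t) z < filling (c # t) z'"
        using filling_range[of z t] ncell_notin[of c t] by (auto simp: cells_Cons filling_Cons)
      then show "filling (c # t) (i, j) < filling (c # t) (i', j')" unfolding z_def z'_def .
    qed
  qed auto
  then show "(i, j) \<in> cells t \<Longrightarrow> (i', j) \<in> cells t \<Longrightarrow> i < i' \<Longrightarrow> filling t (i, j) < filling t (i', j)"
    "(i, j) \<in> cells t \<Longrightarrow> (i, j') \<in> cells t \<Longrightarrow> j < j' \<Longrightarrow> filling t (i, j) < filling t (i, j')" by blast+
qed

lemma filling_in_SYT:
  assumes "valid t" "diagram l = cells t" "sum_list l = length t"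
  shows "filling t \<in> SYT l"
  unfolding SYT_def using assms bij_filling[of t] filling_increasing[OF assms(1)] filling_outside
  by (auto simp: extensional_def)

section \<open>Partitions as down-closed sets of cells\<close>

lemma initial_segment:
  fixes A :: "nat set"
  assumes "finite A" "\<And>i. i \<in> A \<Longrightarrow> 1 \<le> i \<and> (1 < i \<longrightarrow> i - 1 \<in> A)"
  shows "A = {1..card A}"
proof (cases "A = {}")
  case False
  define M where "M = Max A"
  have "A = {1..M}"
  proof
    show "A \<subseteq> {1..M}" using assms M_def Max_ge by fastforce
    show "{1..M} \<subseteq> A"
    proof
      fix k assume "k \<in> {1..M}"
      then have "k \<le> M" "1 \<le> k" by auto
      then show "k \<in> A"
      proof (induction rule: inc_induct)
        case base
        then show ?case using Max_in[OF assms(1) False] M_def by simp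
      next
        case (step i)
        then show ?case using assms(2)[of "Suc i"] by simp
      qed
    qed
  qed
  then show ?thesis by (metis card_atLeastAtMost diff_Suc_1)
qed auto

lemma ex_partition:
  assumes "finite D" "down_closed D"
  shows "\<exists>l. partition_of (card D) l \<and> diagram l = D"
proof -
  define row where "row j = {i. (i, j) \<in> D}" for j
  define h where "h = card {j. (1, j) \<in> D}"
  have finrow: "finite (row j)" for j
    by (rule finite_subset[OF _ finite_imageI[OF assms(1), of fst]]) (force simp: row_def)
  have row: "row j = {1..card (row j)}" for j
    by (rule initial_segment[OF finrow]) (use assms(2) in \<open>auto simp: row_def down_closed_def\<close>)
  have "finite {j. (1, j) \<in> D}"
    by (rule finite_subset[OF _ finite_imageI[OF assms(1), of snd]]) force
  then have col: "{j. (1, j) \<in> D} = {1..h}"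
    unfolding h_def
    by (rule initial_segment) (use assms(2) in \<open>auto simp: down_closed_def\<close>)
  define l where "l = map (\<lambda>j. card (row (Suc j))) [0..<h]"
  have nth: "l ! j = card (row (Suc j))" if "j < h" for j using that unfolding l_def by simp
  have len: "length l = h" unfolding l_def by simp
  have D: "(i, j) \<in> D \<longleftrightarrow> 1 \<le> i \<and> i \<le> card (row j)" for i j using row[of j] unfolding row_def by force
  have jh: "j \<in> {1..h}" if "(i, j) \<in> D" for i j
  proof -
    have "1 \<le> i" using that assms(2) unfolding down_closed_def by blast
    then have "(1, j) \<in> D" using down_closed_left[OF assms(2) that] by simp
    then show ?thesis using col by auto
  qed
  have n1: "l ! (j - 1) = card (row j)" if "1 \<le> j" "j \<le> h" for j
    using nth[of "j - 1"] that by simp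
  have dia: "diagram l = D"
  proof (rule set_eqI, clarify)
    fix i j
    show "(i, j) \<in> diagram l \<longleftrightarrow> (i, j) \<in> D"
      using n1[of j] D[of i j] jh[of i j] len unfolding diagram_def by auto
  qed
  have "sorted_wrt (\<ge>) l"
    unfolding sorted_wrt_iff_nth_less len
  proof (intro allI impI)
    fix a b assume ab: "a < b" "b < h"
    have "row (Suc b) \<subseteq> row (Suc a)"
      using down_closed_down[OF assms(2)] ab unfolding row_def by auto
    then show "l ! b \<le> l ! a" using nth ab card_mono[OF finrow] by simp
  qed
  moreover have "0 \<notin> set l"
  proof
    assume "0 \<in> set l"
    then obtain j where j: "j < h" "card (row (Suc j)) = 0" using nth len by (metis in_set_conv_nth)
    then have "Suc j \<in> {j. (1, j) \<in> D}" unfolding col by auto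
    then show False using j finrow unfolding row_def by auto
  qed
  moreover have "sum_list l = card D"
  proof -
    have "D = (\<Union>j\<in>{..<h}. (\<lambda>i. (i, Suc j)) ` row (Suc j))"
    proof (rule set_eqI, clarify)
      fix i j
      show "(i, j) \<in> D \<longleftrightarrow> (i, j) \<in> (\<Union>j\<in>{..<h}. (\<lambda>i. (i, Suc j)) ` row (Suc j))"
      proof
        assume a: "(i, j) \<in> D"
        then obtain j' where "j = Suc j'" "j' < h" using jh[OF a] by (cases j) auto
        then show "(i, j) \<in> (\<Union>j\<in>{..<h}. (\<lambda>i. (i, Suc j)) ` row (Suc j))" using a unfolding row_def by auto
      qed (auto simp: row_def)
    qed
    then have "card D = card (\<Union>j\<in>{..<h}. (\<lambda>i. (i, Suc j)) ` row (Suc j))" by (rule arg_cong)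
    also have "\<dots> = (\<Sum>j\<in>{..<h}. card ((\<lambda>i. (i, Suc j)) ` row (Suc j)))"
      by (rule card_UN_disjoint) (use finrow in auto)
    also have "\<dots> = (\<Sum>j\<in>{..<h}. card (row (Suc j)))"
      by (intro sum.cong card_image) (auto simp: inj_on_def)
    also have "\<dots> = sum_list l" unfolding l_def by (simp add: interv_sum_list_conv_sum_set_nat atLeast0LessThan)
    finally show ?thesis by simp
  qed
  ultimately show ?thesis using dia unfolding partition_of_def by blast
qed

lemma diagram_bounds:
  assumes "partition_of n l" "(i, j) \<in> diagram l"
  shows "1 \<le> i" "1 \<le> j" "i \<le> sum_list l" "j \<le> sum_list l"
proof -
  have ij: "1 \<le> j" "j \<le> length l" "1 \<le> i" "i \<le> l ! (j - 1)" using assms(2) unfolding diagram_def by auto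
  then have "l ! (j - 1) \<in> set l" by simp
  then have "l ! (j - 1) \<le> sum_list l" by (intro member_le_sum_list) auto
  then show "i \<le> sum_list l" using ij by simp
  have "0 \<notin> set l \<Longrightarrow> length l \<le> sum_list l" by (induction l) (auto simp: Suc_le_eq)
  then show "j \<le> sum_list l" using assms(1) ij unfolding partition_of_def by simp
qed (use assms in \<open>auto simp: diagram_def\<close>)

lemma diagram_inj:
  assumes "partition_of n l" "partition_of n' l'" "diagram l = diagram l'"
  shows "l = l'"
proof -
  have first: "(1, j) \<in> diagram l \<longleftrightarrow> 1 \<le> j \<and> j \<le> length l" if "partition_of n l" for n l j
  proof -
    have "1 \<le> l ! (j - 1)" if "1 \<le> j" "j \<le> length l"
    proof -
      have "l ! (j - 1) \<in> set l" using that by simp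
      then have "l ! (j - 1) \<noteq> 0" using \<open>partition_of n l\<close> unfolding partition_of_def by metis
      then show ?thesis by simp
    qed
    then show ?thesis unfolding diagram_def by auto
  qed
  have len: "length l = length l'"
  proof (rule nat_eq_if_le_iff)
    fix d :: nat assume "1 \<le> d"
    then show "d \<le> length l \<longleftrightarrow> d \<le> length l'"
      using first[OF assms(1), of d] first[OF assms(2), of d] unfolding assms(3) by blast
  qed
  show ?thesis
  proof (rule nth_equalityI[OF len])
    fix j assume j: "j < length l"
    have *: "i \<le> l ! j \<longleftrightarrow> (i, Suc j) \<in> diagram l" "i \<le> l' ! j \<longleftrightarrow> (i, Suc j) \<in> diagram l'"
      if "1 \<le> i" for i
      using j len that unfolding diagram_def by auto
    show "l ! j = l' ! j" by (rule nat_eq_if_le_iff) (simp only: * assms(3))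
  qed
qed

text \<open>The cell of the largest entry ends its row and its column. Removing it leaves a smaller
  tableau, and its content becomes the head of the sequence.\<close>

lemma ex_filling:
  assumes "finite D" "down_closed D" "T \<in> extensional D" "bij_betw T D {1..card D}"
    and "\<And>i i' j. (i, j) \<in> D \<Longrightarrow> (i', j) \<in> D \<Longrightarrow> i < i' \<Longrightarrow> T (i, j) < T (i', j)"
    and "\<And>i j j'. (i, j) \<in> D \<Longrightarrow> (i, j') \<in> D \<Longrightarrow> j < j' \<Longrightarrow> T (i, j) < T (i, j')"
  shows "\<exists>t. valid t \<and> cells t = D \<and> T = filling t"
  using assms
proof (induction "card D" arbitrary: D T)
  case 0
  then have "D = {}" by simp
  then show ?case using 0 by (intro exI[of _ "[]"]) (auto simp: extensional_def)
next
  case (Suc m)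
  note dc = Suc.prems(2)
  have "Suc m \<in> T ` D" using Suc.prems(4) Suc.hyps(2) by (auto simp: bij_betw_def)
  then obtain i j where z: "(i, j) \<in> D" "T (i, j) = Suc m" by auto
  have le: "T z \<le> Suc m" if "z \<in> D" for z using Suc.prems(4) Suc.hyps(2) that by (auto simp: bij_betw_def)
  define D' where "D' = D - {(i, j)}"
  have card': "card D' = m" using z Suc.hyps(2) Suc.prems(1) unfolding D'_def by simp
  have ij: "1 \<le> i" "1 \<le> j" using z dc unfolding down_closed_def by blast+
  have nx: "(i', j) \<notin> D" if "i < i'" for i' using Suc.prems(5)[OF z(1) _ that] le z(2) by fastforce
  have ny: "(i, j') \<notin> D" if "j < j'" for j' using Suc.prems(6)[OF z(1) _ that] le z(2) by fastforce
  have dc': "down_closed D'"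
    unfolding down_closed_def
  proof (intro allI impI)
    fix a b assume ab: "(a, b) \<in> D'"
    then have "1 \<le> a \<and> 1 \<le> b \<and> (1 < a \<longrightarrow> (a - 1, b) \<in> D) \<and> (1 < b \<longrightarrow> (a, b - 1) \<in> D)"
      using dc unfolding D'_def down_closed_def by blast
    moreover have "(a - 1, b) \<noteq> (i, j)" if "1 < a" using nx[of a] ab that unfolding D'_def by auto
    moreover have "(a, b - 1) \<noteq> (i, j)" if "1 < b" using ny[of b] ab that unfolding D'_def by auto
    ultimately show "1 \<le> a \<and> 1 \<le> b \<and> (1 < a \<longrightarrow> (a - 1, b) \<in> D') \<and> (1 < b \<longrightarrow> (a, b - 1) \<in> D')"
      unfolding D'_def by blast
  qed
  define T' where "T' = T((i, j) := undefined)"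
  have T'T: "T' z = T z" if "z \<in> D'" for z using that unfolding D'_def T'_def by auto
  have "bij_betw T D' ({1..Suc m} - {Suc m})"
    using bij_betw_DiffI[OF Suc.prems(4), of "{(i, j)}" "{Suc m}"] z Suc.hyps(2)
    unfolding D'_def by (simp add: bij_betw_def)
  moreover have "{1..Suc m} - {Suc m} = {1..card D'}" using card' by auto
  ultimately have "bij_betw T D' {1..card D'}" by simp
  then have bij': "bij_betw T' D' {1..card D'}" using T'T bij_betw_cong[of D' T' T] by blast
  have sub: "D' \<subseteq> D" unfolding D'_def by blast
  have "\<exists>t. valid t \<and> cells t = D' \<and> T' = filling t"
  proof (rule Suc.hyps(1)[OF card'[symmetric] _ dc' _ bij'])
    show "finite D'" using Suc.prems(1) unfolding D'_def by simp
    show "T' \<in> extensional D'" using Suc.prems(3) unfolding T'_def D'_def extensional_def by auto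
    show "T' (i, j) < T' (i', j)" if "(i, j) \<in> D'" "(i', j) \<in> D'" "i < i'" for i i' j
      using Suc.prems(5)[of i j i'] that T'T sub by auto
    show "T' (i, j) < T' (i, j')" if "(i, j) \<in> D'" "(i, j') \<in> D'" "j < j'" for i j j'
      using Suc.prems(6)[of i j j'] that T'T sub by auto
  qed
  then obtain t where t: "valid t" "cells t = D'" "T' = filling t" by blast
  define c where "c = int i - int j"
  have left: "1 < i \<Longrightarrow> (i - 1, j) \<in> cells t"
    and down: "1 < j \<Longrightarrow> (i, j - 1) \<in> cells t"
    using dc z(1) unfolding t D'_def down_closed_def by auto
  have diag: "(i - 1, j - 1) \<in> cells t" if "1 < i" "1 < j"
    using left[OF that(1)] dc' that(2) unfolding t(2) down_closed_def by blast
  \<comment> \<open>The removed cell is the next free one on its diagonal, because its southwest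
    neighbor, if any, is filled.\<close>
  have cnt: "min i j = Suc (count_list t c)"
  proof -
    have "\<not> min i j \<le> count_list t c"
    proof
      assume "min i j \<le> count_list t c"
      then have "(i, j) \<in> cells t" using ij unfolding cells_def c_def by simp
      then show False unfolding t D'_def by simp
    qed
    moreover have "min i j \<le> Suc (count_list t c)"
    proof (cases "1 < i \<and> 1 < j")
      case True
      then have "int (i - 1) - int (j - 1) = c" unfolding c_def by auto
      then have "min (i - 1) (j - 1) \<le> count_list t c" using diag True unfolding cells_def by auto
      then show ?thesis by (auto simp: min_def split: if_splits)
    qed (use ij in auto)
    ultimately show ?thesis by simp
  qed
  have nc: "ncell c t = (i, j)" unfolding cell_eq_iff using cnt c_def by simp
  \<comment> \<open>The left and the lower neighbor bound the two adjacent diagonals from below;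
    \<open>shape_count\<close> turns this into the steps required of an addable cell.\<close>
  have l: "min (i - 1) j \<le> count_list t (c - 1)"
  proof (cases "1 < i")
    case True
    then have "int (i - 1) - int j = c - 1" unfolding c_def by auto
    then show ?thesis using left[OF True] unfolding cells_def by auto
  qed auto
  have d: "min i (j - 1) \<le> count_list t (c + 1)"
  proof (cases "1 < j")
    case True
    then have "int i - int (j - 1) = c + 1" unfolding c_def by auto
    then show ?thesis using down[OF True] unfolding cells_def by auto
  qed auto
  have "(of_bool (shape t c) :: int) \<le> 0"
    using shape_count[OF t(1), of c] l cnt ij unfolding c_def
    by (cases "j < i") (auto simp: min_def split: if_splits)
  moreover have "(of_bool (shape t (c + 1)) :: int) \<ge> 1"
    using shape_count[OF t(1), of "c + 1"] d cnt ij unfolding c_def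
    by (cases "i < j") (auto simp: min_def split: if_splits)
  ultimately have "addable (shape t) c" unfolding addable_def by (auto simp: of_bool_def split: if_splits)
  moreover have "cells (c # t) = D" unfolding cells_Cons nc t(2) D'_def using z(1) by auto
  moreover have "length t = m" using card_cells[of t] t(2) card' by simp
  then have "filling (c # t) = (filling t)((i, j) := Suc m)" by (simp add: filling.simps(2) nc)
  then have "T = filling (c # t)" using z(2) unfolding t(3)[symmetric] T'_def by (metis fun_upd_upd fun_upd_triv)
  ultimately show ?case using t(1) by (intro exI[of _ "c # t"]) simp
qed

lemma down_closed_diagram:
  assumes "partition_of n l"
  shows "down_closed (diagram l)"
  unfolding down_closed_def
proof (intro allI impI)
  fix i j assume "(i, j) \<in> diagram l"
  then have ij: "1 \<le> j" "j \<le> length l" "1 \<le> i" "i \<le> l ! (j - 1)" unfolding diagram_def by auto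
  have "l ! (j - 1) \<le> l ! (j - 1 - 1)" if "1 < j"
    using assms that ij unfolding partition_of_def sorted_wrt_iff_nth_less by auto
  then show "1 \<le> i \<and> 1 \<le> j \<and> (1 < i \<longrightarrow> (i - 1, j) \<in> diagram l) \<and> (1 < j \<longrightarrow> (i, j - 1) \<in> diagram l)"
    using ij unfolding diagram_def by force
qed

lemma SYT_filling:
  assumes "partition_of n l" "T \<in> SYT l"
  shows "\<exists>t. valid t \<and> length t = n \<and> cells t = diagram l \<and> T = filling t"
proof -
  have bij: "bij_betw T (diagram l) {1..sum_list l}" using assms(2) unfolding SYT_def by auto
  then have c: "card (diagram l) = sum_list l" using bij_betw_same_card by fastforce
  have "finite (diagram l)" using bij bij_betw_finite by blast
  then obtain t where t: "valid t" "cells t = diagram l" "T = filling t"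
    using ex_filling[OF _ down_closed_diagram[OF assms(1)], of T] assms(2) c unfolding SYT_def by auto
  moreover have "length t = n" using card_cells[of t] t c assms(1) unfolding partition_of_def by simp
  ultimately show ?thesis by blast
qed

section \<open>Reading words and dual equivalences of tableaux\<close>

lemma set_reading_order:
  assumes "partition_of n l"
  shows "set (reading_order l) = diagram l"
proof -
  have "i \<in> set [1..<sum_list l + 1] \<and> j \<in> set [1..<sum_list l + 1]" if "(i, j) \<in> diagram l" for i j
    using diagram_bounds[OF assms that] by (auto simp: le_less)
  then show ?thesis unfolding reading_order_def by auto
qed

lemma distinct_reading_order: "distinct (reading_order l)"
  unfolding reading_order_def by (simp add: distinct_product)

lemma sorted_reading_order: "sorted (map content (reading_order l))"
  unfolding reading_order_def by simp

text \<open>Entries on different diagonals are ordered in the reading word by content alone. This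
  suffices for the signature, as consecutive letters never share a diagonal.\<close>

lemma left_of_map:
  assumes "sorted (map f cs)" "inj_on T (set cs)" "z \<in> set cs" "z' \<in> set cs" "f z \<noteq> f z'"
  shows "left_of (map T cs) (T z) (T z') \<longleftrightarrow> f z < (f z' :: int)"
proof
  assume "left_of (map T cs) (T z) (T z')"
  then obtain p q where pq: "p < q" "q < length cs" "T (cs ! p) = T z" "T (cs ! q) = T z'"
    unfolding left_of_def by auto
  then have "cs ! p = z" "cs ! q = z'"
    using assms(2-4) by (meson inj_onD nth_mem order.strict_trans)+
  then show "f z < f z'" using sorted_nth_mono[OF assms(1), of p q] pq assms(5) by auto
next
  assume a: "f z < f z'"
  obtain p q where pq: "p < length cs" "cs ! p = z" "q < length cs" "cs ! q = z'"
    using assms(3,4) by (metis in_set_conv_nth)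
  have "p < q"
  proof (rule ccontr)
    assume "\<not> p < q"
    then show False using sorted_nth_mono[OF assms(1), of q p] pq a by auto
  qed
  then show "left_of (map T cs) (T z) (T z')" using pq unfolding left_of_def by (intro exI[of _ p] exI[of _ q]) auto
qed

lemma asc_nth: "1 \<le> i \<Longrightarrow> i < length t \<Longrightarrow> asc i t \<longleftrightarrow> rev t ! (i - 1) < rev t ! i"
proof (induction t)
  case (Cons c t)
  show ?case
  proof (cases "length t = i")
    case True
    then have "t \<noteq> []" using Cons.prems by auto
    then have "hd t = rev t ! (i - 1)" using True by (metis hd_rev last_conv_nth length_rev rev_is_Nil_conv rev_rev_ident)
    then show ?thesis using True Cons.prems by (simp add: nth_append)
  next
    case False
    then show ?thesis using Cons by (auto simp: nth_append)
  qed
qed auto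

lemma valid_nth_neq: "valid t \<Longrightarrow> 1 \<le> i \<Longrightarrow> i < length t \<Longrightarrow> rev t ! (i - 1) \<noteq> rev t ! i"
proof (induction t)
  case (Cons c t)
  show ?case
  proof (cases "length t = i")
    case True
    then obtain b s where b: "t = b # s" using Cons.prems by (cases t) auto
    then show ?thesis using True Cons.prems valid2_neq[of c b s] by (auto simp: nth_append)
  next
    case False
    then show ?thesis using Cons by (auto simp: nth_append)
  qed
qed auto

lemma valid_nth_neq2: "valid t \<Longrightarrow> 2 \<le> i \<Longrightarrow> i < length t \<Longrightarrow> rev t ! (i - 2) \<noteq> rev t ! i"
proof (induction t)
  case (Cons c t)
  show ?case
  proof (cases "length t = i")
    case True
    then obtain b a s where b: "t = b # a # s" using Cons.prems
      by (metis One_nat_def Suc_le_length_iff numeral_2_eq_2)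
    then show ?thesis using True Cons.prems valid3_neq[of c b a s] by (auto simp: nth_append)
  next
    case False
    then show ?thesis using Cons by (auto simp: nth_append)
  qed
qed auto

lemma ex_letter: "1 \<le> i \<Longrightarrow> i \<le> length t \<Longrightarrow> \<exists>z\<in>cells t. filling t z = i \<and> content z = rev t ! (i - 1)"
proof -
  assume "1 \<le> i" "i \<le> length t"
  then have "i \<in> filling t ` cells t" using bij_filling[of t] by (auto simp: bij_betw_def)
  then show ?thesis using content_filling by force
qed

lemma descent_sig_filling:
  assumes "partition_of n l" "valid t" "cells t = diagram l" "1 \<le> i" "i < length t"
  shows "descent_sig l (filling t) i = (if asc i t then 1 else -1)"
proof -
  obtain z where z: "z \<in> cells t" "filling t z = i" "content z = rev t ! (i - 1)"
    using ex_letter[of i t] assms by auto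
  obtain z' where z': "z' \<in> cells t" "filling t z' = i + 1" "content z' = rev t ! i"
    using ex_letter[of "i + 1" t] assms by auto
  have "left_of (map (filling t) (reading_order l)) (filling t z) (filling t z') \<longleftrightarrow> content z < content z'"
    by (rule left_of_map[OF sorted_reading_order])
      (use z z' set_reading_order[OF assms(1)] assms(3) bij_filling[of t] valid_nth_neq[OF assms(2,4,5)]
        in \<open>auto simp: bij_betw_def\<close>)
  then show ?thesis unfolding descent_sig_def content_word_def using z z' asc_nth[OF assms(4,5)] by simp
qed

lemma count_dual_equiv: "count_list (dual_equiv i t) x = count_list t x"
proof (induction t)
  case (Cons c t)
  have "count_list (top3 s) x = count_list s x" for s by (cases s rule: top3.cases) auto
  then show ?case using Cons by (auto simp del: top3.simps)
qed auto

text \<open>The exchanged contents differ, so each of the two cells is the next free one on its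
  diagonal whichever is filled first; only the letters trade places.\<close>

lemma filling_dual_equiv:
  assumes "2 \<le> i" "i < length t" "valid t" "z \<in> cells t"
    and "x1 = rev t ! (i - 2)" "x2 = rev t ! (i - 1)" "x3 = rev t ! i"
  shows "x1 < x3 \<and> x3 < x2 \<or> x2 < x3 \<and> x3 < x1 \<Longrightarrow> filling (dual_equiv i t) z = Transposition.transpose (i - 1) i (filling t z)"
    and "x2 < x1 \<and> x1 < x3 \<or> x3 < x1 \<and> x1 < x2 \<Longrightarrow> filling (dual_equiv i t) z = Transposition.transpose i (i + 1) (filling t z)"
proof -
  have "(x1 < x3 \<and> x3 < x2 \<or> x2 < x3 \<and> x3 < x1 \<longrightarrow> filling (dual_equiv i t) z = Transposition.transpose (i - 1) i (filling t z)) \<and>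
    (x2 < x1 \<and> x1 < x3 \<or> x3 < x1 \<and> x1 < x2 \<longrightarrow> filling (dual_equiv i t) z = Transposition.transpose i (i + 1) (filling t z))"
    using assms
  proof (induction t)
    case (Cons c t)
    show ?case
    proof (cases "length t = i")
      case True
      then obtain b a s where b: "t = b # a # s" using Cons.prems(1)
        by (metis One_nat_def Suc_le_length_iff numeral_2_eq_2)
      have x: "x3 = c" "x2 = b" "x1 = a" using Cons.prems True b by (auto simp: nth_append)
      have ne: "a \<noteq> b" "b \<noteq> c" "a \<noteq> c" using Cons.prems(3) b valid3_neq by metis+
      have i: "i = Suc (Suc (length s))" using True b by simp
      have r: "filling s z \<le> length s" if "z \<in> cells s" using filling_range[OF that] by simp
      have "z \<in> {ncell c s, ncell b s, ncell a s} \<union> cells s"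
        using Cons.prems(4) ne by (auto simp: b cells_Cons)
      moreover have "ncell c s \<notin> cells s" "ncell b s \<notin> cells s" "ncell a s \<notin> cells s"
        using ncell_notin by auto
      ultimately show ?thesis
        unfolding x b using ne i r
        by (auto simp: filling_Cons Transposition.transpose_def)
    next
      case False
      then have lt: "i < length t" "i - 1 < length t" "i - 2 < length t" using Cons.prems by auto
      have x': "x1 = rev t ! (i - 2)" "x2 = rev t ! (i - 1)" "x3 = rev t ! i"
        using Cons.prems(5-7) lt by (simp_all add: nth_append)
      have "valid t" using Cons.prems(3) by simp
      note IH = Cons.IH[OF Cons.prems(1) lt(1) this _ x']
      show ?thesis using False lt(1) IH Cons.prems(4)
        by (auto simp: filling_Cons cells_Cons count_dual_equiv Transposition.transpose_def)
    qed
  qed auto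
  then show "x1 < x3 \<and> x3 < x2 \<or> x2 < x3 \<and> x3 < x1 \<Longrightarrow> filling (dual_equiv i t) z = Transposition.transpose (i - 1) i (filling t z)"
    and "x2 < x1 \<and> x1 < x3 \<or> x3 < x1 \<and> x1 < x2 \<Longrightarrow> filling (dual_equiv i t) z = Transposition.transpose i (i + 1) (filling t z)"
    by blast+
qed

lemma elem_dual_equiv_filling:
  assumes "partition_of n l" "valid t" "cells t = diagram l" "2 \<le> i" "i < length t"
    "asc (i - 1) t \<noteq> asc i t"
  shows "elem_dual_equiv i (content_word l (filling t)) (content_word l (filling (dual_equiv i t)))"
proof -
  define x1 x2 x3 where "x1 = rev t ! (i - 2)" and "x2 = rev t ! (i - 1)" and "x3 = rev t ! i"
  have ne: "x1 \<noteq> x2" "x2 \<noteq> x3" "x1 \<noteq> x3"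
    using valid_nth_neq[OF assms(2), of "i - 1"] valid_nth_neq[OF assms(2), of i]
      valid_nth_neq2[OF assms(2), of i] assms(4,5)
    by (auto simp: x1_def x2_def x3_def numeral_2_eq_2)
  have asc: "x1 < x2 \<longleftrightarrow> \<not> x2 < x3"
    using asc_nth[of "i - 1" t] asc_nth[of i t] assms(4-6)
    by (auto simp: x1_def x2_def x3_def numeral_2_eq_2)
  obtain z1 where z1: "z1 \<in> cells t" "filling t z1 = i - 1" "content z1 = x1"
  proof -
    have le: "1 \<le> i - 1" "i - 1 \<le> length t" using assms(4,5) by auto
    have "i - 1 - 1 = i - 2" by simp
    then show ?thesis using that ex_letter[OF le] unfolding x1_def by metis
  qed
  obtain z2 where z2: "z2 \<in> cells t" "filling t z2 = i" "content z2 = x2"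
    using ex_letter[of i t] assms by (auto simp: x2_def)
  obtain z3 where z3: "z3 \<in> cells t" "filling t z3 = i + 1" "content z3 = x3"
    using ex_letter[of "i + 1" t] assms by (auto simp: x3_def)
  let ?ro = "reading_order l" and ?P = "\<lambda>z. filling t z \<in> {i - 1, i, i + 1}"
  have ro: "set ?ro = cells t" using set_reading_order assms by metis
  define fl where "fl = filter ?P ?ro"
  have inj: "inj_on (filling t) (cells t)" using bij_filling by (auto simp: bij_betw_def)
  have "set fl = {z1, z2, z3}"
  proof
    show "set fl \<subseteq> {z1, z2, z3}"
    proof
      fix z assume "z \<in> set fl"
      then have "z \<in> cells t" "filling t z \<in> {filling t z1, filling t z2, filling t z3}"
        using z1(2) z2(2) z3(2) by (auto simp: fl_def ro)
      then show "z \<in> {z1, z2, z3}" using inj_onD[OF inj] z1(1) z2(1) z3(1) by blast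
    qed
    show "{z1, z2, z3} \<subseteq> set fl" using z1 z2 z3 by (auto simp: fl_def ro)
  qed
  moreover have d: "distinct fl" using distinct_reading_order fl_def by simp
  moreover have "distinct [z1, z2, z3]" using z1 z2 z3 ne by auto
  ultimately have "length fl = 3" by (metis distinct_card length_Cons list.set(1,2) list.size(3) numeral_3_eq_3)
  then obtain u0 u1 u2 where fl: "fl = [u0, u1, u2]"
    by (auto simp: numeral_3_eq_3 length_Suc_conv)
  have "sorted (map content fl)" using sorted_reading_order fl_def sorted_filter by metis
  \<comment> \<open>Word order is content order, so \<open>u1\<close> is the cell of the letter with
    the middle content and \<open>u0\<close>, \<open>u2\<close> are the outermost ones.\<close>
  then have so: "content u0 \<le> content u1" "content u1 \<le> content u2" using fl by auto
  have st: "{u0, u1, u2} = {z1, z2, z3}" using \<open>set fl = {z1, z2, z3}\<close> fl by simp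
  have du: "u0 \<noteq> u1" "u1 \<noteq> u2" "u0 \<noteq> u2" using d fl by auto
  have s: "filter (\<lambda>a. a \<in> {i - 1, i, i + 1}) (content_word l (filling t)) = [filling t u0, filling t u1, filling t u2]"
    unfolding content_word_def filter_map using fl unfolding fl_def comp_def by simp
  have mem: "u0 \<in> {z1, z2, z3}" "u1 \<in> {z1, z2, z3}" "u2 \<in> {z1, z2, z3}" using st by auto
  have "filling t u1 \<noteq> i \<and> (\<forall>z\<in>cells t. filling (dual_equiv i t) z = Transposition.transpose (filling t u0) (filling t u2) (filling t z))"
  proof -
    consider "x1 < x3 \<and> x3 < x2 \<or> x2 < x3 \<and> x3 < x1" | "x2 < x1 \<and> x1 < x3 \<or> x3 < x1 \<and> x1 < x2"
      using ne asc by linarith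
    then show ?thesis
    proof cases
      case 1
      then have "u1 = z3" "u0 = z1 \<and> u2 = z2 \<or> u0 = z2 \<and> u2 = z1"
        using mem du so z1(3) z2(3) z3(3) by auto
      moreover from this have "Transposition.transpose (filling t u0) (filling t u2) = Transposition.transpose (i - 1) i"
        using z1(2) z2(2) transpose_commute by metis
      ultimately show ?thesis
        using filling_dual_equiv(1)[OF assms(4,5,2) _ x1_def x2_def x3_def 1] z3(2) by simp
    next
      case 2
      then have "u1 = z1" "u0 = z2 \<and> u2 = z3 \<or> u0 = z3 \<and> u2 = z2"
        using mem du so z1(3) z2(3) z3(3) by auto
      moreover from this have "Transposition.transpose (filling t u0) (filling t u2) = Transposition.transpose i (i + 1)"
        using z2(2) z3(2) transpose_commute by metis
      moreover have "i - 1 \<noteq> i" using assms(4) by linarith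
      ultimately show ?thesis
        using filling_dual_equiv(2)[OF assms(4,5,2) _ x1_def x2_def x3_def 2] z1(2) by simp
    qed
  qed
  then show ?thesis unfolding elem_dual_equiv_def Let_def s unfolding content_word_def using ro by simp
qed

text \<open>The transposed letters are among \<open>i - 1\<close>, \<open>i\<close>,
  \<open>i + 1\<close>, whereas \<open>rev t ! k\<close> belongs to the letter \<open>k + 1\<close>,
  which is larger and keeps its cell.\<close>

lemma elem_dual_equiv_far:
  assumes "partition_of n l" "cells t = diagram l" "cells t' = diagram l"
    "elem_dual_equiv i (content_word l (filling t)) (content_word l (filling t'))"
    "2 \<le> i" "i < k" "k < length t" "length t' = length t"
  shows "rev t ! k = rev t' ! k"
proof -
  let ?w = "content_word l (filling t)"
  define s where "s = filter (\<lambda>a. a \<in> {i - 1, i, i + 1}) ?w"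
  have ro: "set (reading_order l) = cells t" using set_reading_order assms by metis
  have "set ?w = {1..length t}" using bij_filling[of t] ro unfolding content_word_def by (auto simp: bij_betw_def)
  then have ss: "set s = {i - 1, i, i + 1}" using assms(5-7) unfolding s_def by auto
  moreover have "i - 1 \<noteq> i" "i - 1 \<noteq> i + 1" "i \<noteq> i + 1" using assms(5) by linarith+
  then have "card {i - 1, i, i + 1} = 3" by simp
  ultimately have "3 \<le> length s" using card_length[of s] by simp
  then have "0 < length s" "2 < length s" by linarith+
  then have "s ! 0 \<in> set s" "s ! 2 \<in> set s" using nth_mem by blast+
  then have s02: "s ! 0 < k + 1" "s ! 2 < k + 1" using ss assms(6) by auto
  have "content_word l (filling t') = map (Transposition.transpose (s ! 0) (s ! 2)) ?w"
    using assms(4) unfolding elem_dual_equiv_def Let_def s_def by simp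
  then have T: "filling t' z = Transposition.transpose (s ! 0) (s ! 2) (filling t z)" if "z \<in> cells t" for z
    using that ro unfolding content_word_def by auto
  obtain z where z: "z \<in> cells t" "filling t z = k + 1" "content z = rev t ! k"
    using ex_letter[of "k + 1" t] assms(7) by auto
  have "filling t' z = k + 1" using T[OF z(1)] z(2) s02 by simp
  then have "content z = rev t' ! k" using content_filling[of z t'] z(1) assms(2,3) by simp
  then show ?thesis using z(3) by simp
qed

lemma filling_inj:
  assumes "cells t = cells t'" "filling t = filling t'"
  shows "t = t'"
proof -
  have len: "length t = length t'" using card_cells assms(1) by metis
  have "rev t = rev t'"
  proof (rule nth_equalityI)
    fix k assume k: "k < length (rev t)"
    then obtain z where z: "z \<in> cells t" "filling t z = k + 1" "content z = rev t ! k"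
      using ex_letter[of "k + 1" t] by auto
    then show "rev t ! k = rev t' ! k" using content_filling[of z t'] assms by simp
  qed (use len in simp)
  then show ?thesis by simp
qed

context deg
begin

lemma labelling_top: "labelling n" "partial_label n n"
  using labelling_all[OF order_refl] labellingD(1) by blast+

section \<open>Components are standard graphs\<close>

lemma edges_subset_comp:
  assumes "W = comp n v" "i \<in> {2..<n}" "{u, w} \<in> edges (induced_subgraph G W) i"
  shows "E i u w"
  using assms unfolding induced_subgraph_def E_def by auto

lemma comp_isomorphic:
  assumes v: "v \<in> V" and l: "partition_of n l" "diagram l = cells (label n v)"
  shows "isomorphic n n (induced_subgraph G (comp n v)) (standard_graph l)"
proof -
  let ?W = "comp n v" and ?\<psi> = "\<lambda>u. filling (label n u)"
  note partial_label = labelling_top(2)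
  have sum: "sum_list l = n" using l(1) unfolding partition_of_def by simp
  have WV: "u \<in> V" if "u \<in> ?W" for u using comp_V[OF that] by simp
  have val: "valid (label n u)" if "u \<in> ?W" for u using partial_labelD(1)[OF partial_label WV[OF that]] .
  have cells: "cells (label n u) = diagram l" if "u \<in> ?W" for u
    using cells_eq_shape[OF val[OF that] partial_labelD(1)[OF partial_label v]] partial_label_shape[OF partial_label that] l(2) by simp
  have SYT: "?\<psi> u \<in> SYT l" if "u \<in> ?W" for u
    using filling_in_SYT[OF val[OF that]] cells[OF that] sum by simp
  have "sig G u i = descent_sig l (?\<psi> u) i" if "u \<in> ?W" "i \<in> {1..<n}" for u i
    using descent_sig_filling[OF l(1) val[OF that(1)] cells[OF that(1)], of i] that(2)
      partial_labelD(2)[OF partial_label WV[OF that(1)], of i] sig_S[OF WV[OF that(1)], of i] by simp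
  moreover have "{?\<psi> u, ?\<psi> w} \<in> edges (standard_graph l) i"
    if i: "i \<in> {2..<n}" and uw: "u \<in> ?W" "w \<in> ?W" "{u, w} \<in> edges (induced_subgraph G ?W) i" for i u w
  proof -
    have e: "E i u w" using edges_subset_comp[OF refl i uw(3)] .
    have le: "Suc 0 \<le> i - Suc 0" "i - Suc 0 < n" using i by auto
    have "asc (i - 1) (label n u) \<noteq> asc i (label n u)"
      using E_flip(3)[OF e] partial_labelD(2)[OF partial_label WV[OF uw(1)], of i] partial_labelD(2)[OF partial_label WV[OF uw(1)], of "i - 1"]
        i le by auto
    then have "elem_dual_equiv i (content_word l (?\<psi> u)) (content_word l (filling (dual_equiv i (label n u))))"
      using elem_dual_equiv_filling[OF l(1) val[OF uw(1)] cells[OF uw(1)], of i] i by simp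
    then have "elem_dual_equiv i (content_word l (?\<psi> u)) (content_word l (?\<psi> w))"
      using partial_labelD(3)[OF partial_label e] i by simp
    then show ?thesis
      using SYT[OF uw(1)] SYT[OF uw(2)] i sum unfolding standard_graph_def by auto
  qed
  ultimately have "morphism n n ?\<psi> (induced_subgraph G ?W) (standard_graph l)"
    using SYT unfolding morphism_def by (auto simp: induced_subgraph_def standard_graph_def)
  moreover have "inj_on ?\<psi> ?W"
  proof (rule inj_onI)
    fix u w assume uw: "u \<in> ?W" "w \<in> ?W" "?\<psi> u = ?\<psi> w"
    then have "label n u = label n w" using filling_inj cells by metis
    moreover have "w \<in> comp n u" using uw comp_eq by metis
    ultimately show "u = w" using labellingD(2)[OF labelling_top(1)] by blast
  qed
  \<comment> \<open>Surjectivity lifts the connectedness of the standard graph.\<close>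
  moreover have "SYT l \<subseteq> ?\<psi> ` ?W"
  proof
    fix T assume "T \<in> SYT l"
    then obtain t where t: "valid t" "length t = n" "cells t = diagram l" "T = filling t"
      using SYT_filling[OF l(1)] by blast
    then have "shape t = shape (label n v)" using cells_eq_shape[OF t(1) partial_labelD(1)[OF partial_label v]] l(2) by simp
    then obtain u where "u \<in> ?W" "label n u = t"
      using reach[OF partial_label order_refl v, of "[]" "label n v" t] t by auto
    then show "T \<in> ?\<psi> ` ?W" using t(4) by blast
  qed
  then have "?\<psi> ` ?W = SYT l" using SYT by blast
  ultimately show ?thesis
    unfolding isomorphic_def bij_betw_def by (auto simp: induced_subgraph_def standard_graph_def)
qed

text \<open>\<open>R u\<close> is the content sequence of the tableau \<open>\<phi> u\<close>. From
  the smallest letter on, each of its entries solves \<open>next_content\<close>, and by uniqueness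
  it agrees with the label.\<close>

lemma isomorphic_diagram:
  assumes v: "v \<in> V" and l: "partition_of n l"
    and "isomorphic n n (induced_subgraph G (comp n v)) (standard_graph l)"
  shows "diagram l = cells (label n v)"
proof -
  let ?W = "comp n v"
  obtain \<phi> where mor: "morphism n n \<phi> (induced_subgraph G ?W) (standard_graph l)"
    using assms(3) unfolding isomorphic_def by blast
  have sum: "sum_list l = n" using l unfolding partition_of_def by simp
  have WV: "u \<in> V" if "u \<in> ?W" for u using comp_V[OF that] by simp
  have "\<forall>u\<in>?W. \<exists>t. valid t \<and> length t = n \<and> cells t = diagram l \<and> \<phi> u = filling t"
    using mor SYT_filling[OF l] unfolding morphism_def
    by (auto simp: induced_subgraph_def standard_graph_def)
  then obtain R where R: "\<And>u. u \<in> ?W \<Longrightarrow>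
      valid (R u) \<and> length (R u) = n \<and> cells (R u) = diagram l \<and> \<phi> u = filling (R u)"
    by metis
  have S: "S u i = asc i (R u)" if "u \<in> ?W" "1 \<le> i" "i < n" for u i
  proof -
    have "sig G u i = descent_sig l (\<phi> u) i"
      using mor that unfolding morphism_def by (auto simp: induced_subgraph_def standard_graph_def)
    also have "\<dots> = (if asc i (R u) then 1 else -1)"
      using descent_sig_filling[OF l, of "R u" i] R[OF that(1)] that by simp
    finally show ?thesis unfolding S_def by simp
  qed
  have E: "rev (R u) ! k = rev (R w) ! k" if e: "E i u w" and "u \<in> ?W" "w \<in> ?W" "i < k" "k < n" for i u w k
  proof -
    have i: "i \<in> {2..<n}" using E_range[OF e] by simp
    have "{\<phi> u, \<phi> w} \<in> edges (standard_graph l) i"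
      using mor e i that(2,3) unfolding morphism_def E_def
      by (auto simp: induced_subgraph_def standard_graph_def)
    then have "elem_dual_equiv i (content_word l (\<phi> u)) (content_word l (\<phi> w)) \<or>
        elem_dual_equiv i (content_word l (\<phi> w)) (content_word l (\<phi> u))"
      unfolding standard_graph_def by (auto simp: doubleton_eq_iff)
    then show ?thesis
      using elem_dual_equiv_far[OF l, of "R u" "R w" i k] elem_dual_equiv_far[OF l, of "R w" "R u" i k]
        R[OF that(2)] R[OF that(3)] i that(4,5) by auto
  qed
  \<comment> \<open>The largest letters stand in front, so dropping \<open>n - k\<close> of them
    leaves the letters up to \<open>k\<close>.\<close>
  have "k \<le> n \<Longrightarrow> \<forall>u\<in>?W. label k u = drop (n - k) (R u)" for k
  proof (induction k)
    case (Suc k)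
    then have IH: "label k u = drop (n - k) (R u)" if "u \<in> ?W" for u using that by simp
    have kn: "k < n" using Suc.prems by simp
    have inv: "labelling k" using labelling_all kn by simp
    have dr: "drop (n - Suc k) (R u) = rev (R u) ! k # drop (n - k) (R u)" if "u \<in> ?W" for u
    proof -
      have "n - Suc k < length (R u)" using R[OF that] kn by simp
      moreover have "rev (R u) ! k = R u ! (n - Suc k)" using R[OF that] kn by (simp add: rev_nth)
      moreover have "Suc (n - Suc k) = n - k" using kn by simp
      ultimately show ?thesis by (metis Cons_nth_drop_Suc)
    qed
    show ?case
    proof
      fix u assume u: "u \<in> ?W"
      let ?c = "rev (R u) ! k"
      have "valid (drop (n - Suc k) (R u))"
        using R[OF u] valid_appD[of "take (n - Suc k) (R u)"] by simp
      then have ad: "addable (shape (label k u)) ?c" using dr[OF u] IH[OF u] by simp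
      have "next_content k (label k) u ?c"
        unfolding next_content_def
      proof (intro conjI impI ballI)
        fix w assume k: "0 < k" and w: "w \<in> comp k u"
        have wW: "w \<in> ?W" using comp_trans[OF u comp_mono[OF w]] kn by simp
        \<comment> \<open>Colors below \<open>k\<close> do not move the letter \<open>k + 1\<close>
          of a standard tableau, so the candidate is constant on the component.\<close>
        have "rev (R w) ! k = ?c"
          using w less_imp_le[OF kn]
        proof (induction rule: comp_induct)
          case (step i y z)
          have y: "y \<in> ?W" using comp_trans[OF u comp_mono[OF step(3)]] kn by simp
          have "z \<in> ?W" using comp_trans[OF y comp_E[OF step(1)]] step(2) kn by simp
          then show ?case using E[OF step(1) y _ step(2) kn] step(4) by simp
        qed simp
        moreover have "S w k \<longleftrightarrow> rev (R w) ! (k - 1) < rev (R w) ! k"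
          using S[OF wW, of k] asc_nth[of k "R w"] R[OF wW] k kn by simp
        moreover have "hd (label k w) = rev (R w) ! (k - 1)"
        proof -
          have "hd (label k w) = R w ! (n - k)"
            using IH[OF wW] R[OF wW] kn k by (simp add: hd_drop_conv_nth)
          also have "\<dots> = rev (R w) ! (k - 1)" using R[OF wW] kn k by (simp add: rev_nth)
          finally show ?thesis .
        qed
        ultimately show "S w k \<longleftrightarrow> hd (label k w) < ?c" by simp
      qed (use ad in simp)
      then have "hd (label (Suc k) u) = ?c"
        using next_content_unique[OF inv WV[OF u] next_content_label[OF inv kn WV[OF u]]] by simp
      then show "label (Suc k) u = drop (n - Suc k) (R u)"
        using dr[OF u] IH[OF u] label_Suc_eq[of k u] by simp
    qed
  qed (use R in simp)
  then have "label n v = R v" using comp_refl[OF v, of n] by simp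
  then show ?thesis using R[OF comp_refl[OF v]] by simp
qed

end

theorem theorem3p9:
  fixes n :: nat and G :: "'v sc_graph"
  assumes "0 < n"
    and "dual_equivalence_graph n n G"
    and "W \<in> components G {2..<n}"
  shows "\<exists>!l. partition_of n l \<and> isomorphic n n (induced_subgraph G W) (standard_graph l)"
proof -
  interpret deg n G by unfold_locales (rule assms(2))
  obtain v where v: "v \<in> verts G" and W: "W = comp n v"
    using assms(3) unfolding components_def comp_def by blast
  have val: "valid (label n v)" using partial_labelD(1)[OF labelling_top(2) v] .
  obtain l where "partition_of (card (cells (label n v))) l" "diagram l = cells (label n v)"
    using ex_partition[OF finite_cells down_closed_cells[OF val]] by blast
  then have l: "partition_of n l" "diagram l = cells (label n v)" by (simp_all add: card_cells)
  show ?thesis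
  proof (rule ex1I[of _ l])
    show "partition_of n l \<and> isomorphic n n (induced_subgraph G W) (standard_graph l)"
      using comp_isomorphic[OF v l] l W by simp
    show "l' = l" if "partition_of n l' \<and> isomorphic n n (induced_subgraph G W) (standard_graph l')" for l'
      using isomorphic_diagram[OF v, of l'] that l W diagram_inj[of n l' n l] by auto
  qed
qed

end
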